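(* Let $m,n\in\mathbb N_0$, let $q\in\mathbb C$ with $0<|q|<1$, let $\alpha\in\mathbb C\setminus\{0\}$, and define, for $\beta\in\mathbb C\setminus\{0\}$, $$\Psi_{m,n}(\beta|q):=\sum_{k=-\infty}^\infty(1+q^{2k}\beta^2)\,\mathsf H_n[q^k\beta|q]\,\mathsf H_m[q^k\beta|q]\,q^{2k^2-k}\beta^{4k}.$$ Then $$\Psi_{m,n}(\alpha|q)=\Big(q,-\alpha^2,-\frac q{\alpha^2};q\Big)_\infty\frac{q^{-\binom n2}(q;q)_n}{q^n}\,\delta_{m,n},$$ and $$\int_{-\infty}^\infty(1+q^{2x}\alpha^2)\,\mathsf H_n[q^x\alpha|q]\,\mathsf H_m[q^x\alpha|q]\,q^{2x^2-x}\alpha^{4x}\,dx=\int_0^1\Psi_{m,n}(q^x\alpha|q)\,q^{2x^2-x}\alpha^{4x}\,dx=(q;q)_\infty\frac{q^{-\binom n2}(q;q)_n\,\delta_{m,n}}{q^n}\,\mathsf J(\alpha|q),$$ where $$\mathsf J(\alpha|q):=\int_0^1\Big(-q^{2x}\alpha^2,-\frac{q^{1-2x}}{\alpha^2};q\Big)_\infty q^{2x^2-x}\alpha^{4x}\,dx=\frac1{(q;q)_\infty}\int_{-\infty}^\infty(1+q^{2x}\alpha^2)\,q^{2x^2-x}\alpha^{4x}\,dx=\frac{\sqrt{2\pi}\,\alpha\,\exp\left(\frac{2(\log\alpha)^2}{\log q^{-1}}\right)}{q^{1/8}\sqrt{\log q^{-1}}\,(q;q)_\infty}.$$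
   Context: Notation: $\mathbb N_0=\{0,1,2,\dots\}$. For $n\in\mathbb N_0$, $(y;q)_n=\prod_{j=0}^{n-1}(1-yq^j)$, $(y;q)_\infty=\prod_{j\ge0}(1-yq^j)$, and $(y_1,\dots,y_r;q)_\infty=\prod_i(y_i;q)_\infty$. $\delta_{m,n}$ is the Kronecker delta. Powers are $q^s=\exp(s\log q)$, $\alpha^{s}=\exp(s\log\alpha)$ with principal logarithms, $\log q^{-1}=-\log q$ (which has positive real part), and $\sqrt{\log q^{-1}}$ is the principal square root. The continuous $q^{-1}$-Hermite polynomials are polynomials of degree $n$ in $x=\frac12(z-z^{-1})$, defined by $\mathsf H_n[z|q]=i^{-n}H_n[iz|q^{-1}]$, where $H_n$ is the continuous $q$-Hermite polynomial in standard normalization, written as a function of $w$ with argument $\frac12(w+w^{-1})$. Explicitly, $$\mathsf H_n[z|q]=z^n\sum_{k=0}^n\frac{(q^{-n};q)_k}{(q;q)_k}(-1)^kq^{\binom k2}\Big(-\frac{q}{z^2}\Big)^k.$$ *)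

theory Defs
  imports "HOL-Analysis.Analysis"
begin

definition qpoch :: "complex \<Rightarrow> complex \<Rightarrow> nat \<Rightarrow> complex" where
  "qpoch y q n = (\<Prod>j<n. 1 - y * q ^ j)"

definition qpoch_inf :: "complex \<Rightarrow> complex \<Rightarrow> complex" where
  "qpoch_inf y q = (\<Prod>j. 1 - y * q ^ j)"

lemma convergent_prod_qpoch_inf:
  fixes y q :: complex
  assumes "norm q < 1"
  shows "convergent_prod (\<lambda>j. 1 - y * q ^ j)"
proof -
  have "summable (\<lambda>j. norm y * norm q ^ j)"
    using assms by (intro summable_mult summable_geometric) auto
  also have "(\<lambda>j. norm y * norm q ^ j) = (\<lambda>j. norm ((1 - y * q ^ j) - 1))"
    by (auto simp: norm_mult norm_power)
  finally have "summable (\<lambda>j. norm ((1 - y * q ^ j) - 1))" .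
  thus ?thesis
    using abs_convergent_prod_conv_summable abs_convergent_prod_imp_convergent_prod by blast
qed

definition qpoch_inf_list :: "complex list \<Rightarrow> complex \<Rightarrow> complex" where
  "qpoch_inf_list ys q = (\<Prod>y\<leftarrow>ys. qpoch_inf y q)"

text \<open>
  The continuous \<open>q\<close>-Hermite polynomial in the standard normalization, as a function of \<open>w\<close>:
  its polynomial argument is \<open>(w + 1/w)/2\<close>, i.e. \<open>cos \<theta>\<close> for \<open>w = exp (i\<theta>)\<close>.
\<close>
definition cont_q_Hermite :: "nat \<Rightarrow> complex \<Rightarrow> complex \<Rightarrow> complex" where
  "cont_q_Hermite n w q =
     (\<Sum>k\<le>n. qpoch q q n / (qpoch q q k * qpoch q q (n - k)) * w powi (int n - 2 * int k))"

definition qinv_Hermite :: "nat \<Rightarrow> complex \<Rightarrow> complex \<Rightarrow> complex" where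
  "qinv_Hermite n z q = inverse (\<i> ^ n) * cont_q_Hermite n (\<i> * z) (inverse q)"

lemma qpoch_inverse_self:
  assumes "q \<noteq> 0"
  shows "qpoch (inverse q) (inverse q) k * q ^ (k choose 2) * q ^ k = (-1) ^ k * qpoch q q k"
proof (induction k)
  case (Suc k)
  have c: "Suc k choose 2 = k + (k choose 2)"
    by (simp add: numeral_2_eq_2)
  have "qpoch (inverse q) (inverse q) (Suc k) * q ^ (Suc k choose 2) * q ^ Suc k =
        (qpoch (inverse q) (inverse q) k * q ^ (k choose 2) * q ^ k) *
        ((1 - inverse q ^ Suc k) * q ^ Suc k)"
    by (simp add: qpoch_def c power_add)
  also have "(1 - inverse q ^ Suc k) * q ^ Suc k = - (1 - q * q ^ k)"
    using assms by (simp add: field_simps)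
  also have "qpoch (inverse q) (inverse q) k * q ^ (k choose 2) * q ^ k * - (1 - q * q ^ k) =
             (-1) ^ Suc k * (qpoch q q k * (1 - q * q ^ k))"
    unfolding Suc.IH by (simp add: algebra_simps)
  also have "qpoch q q k * (1 - q * q ^ k) = qpoch q q (Suc k)"
    by (simp add: qpoch_def)
  finally show ?case .
qed (simp_all add: qpoch_def numeral_2_eq_2)

lemma qpoch_inverse_split:
  assumes "q \<noteq> 0" "k \<le> n"
  shows "qpoch (inverse q) (inverse q) n =
         qpoch (inverse q) (inverse q) (n - k) * qpoch (q powi (- int n)) q k"
  using assms(2)
proof (induction k)
  case (Suc k)
  define l where "l = n - Suc k"
  have n: "n - k = Suc l" "n = l + Suc k"
    using Suc.prems by (auto simp: l_def)
  have e: "q powi (- int n) * q ^ k = inverse q ^ Suc l"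
    using assms(1) unfolding n(2) power_int_minus power_int_of_nat
    by (simp add: field_simps power_add)
  have "qpoch (inverse q) (inverse q) n =
        qpoch (inverse q) (inverse q) (n - k) * qpoch (q powi (- int n)) q k"
    using Suc by simp
  also have "qpoch (inverse q) (inverse q) (n - k) =
             qpoch (inverse q) (inverse q) l * (1 - inverse q ^ Suc l)"
    unfolding n by (simp add: qpoch_def)
  also have "1 - inverse q ^ Suc l = 1 - q powi (- int n) * q ^ k"
    using e by simp
  finally show ?case
    by (simp add: qpoch_def l_def mult_ac)
qed (simp add: qpoch_def)

lemma qpoch_self_nonzero:
  assumes "norm q < 1"
  shows "qpoch q q k \<noteq> 0"
proof -
  have "q * q ^ j \<noteq> 1" for j
  proof
    assume "q * q ^ j = 1"
    hence "norm q ^ Suc j = 1"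
      by (metis norm_one norm_power power_Suc)
    thus False
      using assms power_less_one_iff[of "norm q" "Suc j"] by auto
  qed
  thus ?thesis
    by (simp add: qpoch_def)
qed

lemma qinv_Hermite_explicit:
  assumes q: "0 < norm q" "norm q < 1" and z: "z \<noteq> 0"
  shows "qinv_Hermite n z q =
    z ^ n * (\<Sum>k\<le>n. qpoch (q powi (- int n)) q k / qpoch q q k *
                     (-1) ^ k * q ^ (k choose 2) * (- (q / z\<^sup>2)) ^ k)"
proof -
  have q0: "q \<noteq> 0" using q by auto
  let ?p = "inverse q"
  have nz: "qpoch ?p ?p k \<noteq> 0" for k
    using qpoch_inverse_self[OF q0, of k] qpoch_self_nonzero[OF q(2), of k] by auto
  have "inverse (\<i> ^ n) * (qpoch ?p ?p n / (qpoch ?p ?p k * qpoch ?p ?p (n - k)) *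
          (\<i> * z) powi (int n - 2 * int k)) =
        z ^ n * (qpoch (q powi (- int n)) q k / qpoch q q k *
          (-1) ^ k * q ^ (k choose 2) * (- (q / z\<^sup>2)) ^ k)" if k: "k \<le> n" for k
  proof -
    have a: "qpoch ?p ?p n / (qpoch ?p ?p k * qpoch ?p ?p (n - k)) =
             qpoch (q powi (- int n)) q k / qpoch ?p ?p k"
      using nz by (subst qpoch_inverse_split[OF q0 k]) (simp add: field_simps)
    have "qpoch ?p ?p k = (-1) ^ k * qpoch q q k / (q ^ (k choose 2) * q ^ k)"
      using qpoch_inverse_self[OF q0, of k] q0 by (simp add: field_simps)
    hence b: "qpoch (q powi (- int n)) q k / qpoch ?p ?p k =
              qpoch (q powi (- int n)) q k / qpoch q q k * (-1) ^ k * q ^ (k choose 2) * q ^ k"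
      by (cases "even k") (simp_all add: field_simps)
    have "(\<i> * z) powi (int n - 2 * int k) = (\<i> * z) ^ n / ((\<i> * z) ^ 2) ^ k"
      using z by (simp add: power_int_diff power_int_mult)
    also have "((\<i> * z) ^ 2) ^ k = (- (z\<^sup>2)) ^ k"
      by (simp add: power_mult_distrib)
    finally have c: "inverse (\<i> ^ n) * (\<i> * z) powi (int n - 2 * int k) = z ^ n / (- (z\<^sup>2)) ^ k"
      by (simp add: power_mult_distrib)
    have d: "(- (q / z\<^sup>2)) ^ k = q ^ k / (- (z\<^sup>2)) ^ k"
      by (metis divide_minus_right power_divide)
    show ?thesis
      unfolding a b d mult.left_commute[of "inverse (\<i> ^ n)"] c by simp
  qed
  thus ?thesis
    unfolding qinv_Hermite_def cont_q_Hermite_def sum_distrib_left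
    by (intro sum.cong) auto
qed

definition Psi :: "nat \<Rightarrow> nat \<Rightarrow> complex \<Rightarrow> complex \<Rightarrow> complex" where
  "Psi m n \<beta> q =
     (\<Sum>\<^sub>\<infinity>k::int\<in>UNIV. (1 + q powi (2 * k) * \<beta>\<^sup>2)
        * qinv_Hermite n (q powi k * \<beta>) q * qinv_Hermite m (q powi k * \<beta>) q
        * q powi (2 * k\<^sup>2 - k) * \<beta> powi (4 * k))"

text \<open>
  For non-integer exponents, \<open>powr\<close> on \<open>complex\<close> is the principal power \<open>exp (s * Ln b)\<close>.
\<close>
definition J_integral :: "complex \<Rightarrow> complex \<Rightarrow> complex" where
  "J_integral \<alpha> q =
     (LINT x:{0..1}|lborel.
        qpoch_inf_list [- (q powr (2 * of_real x)) * \<alpha>\<^sup>2, - (q powr (1 - 2 * of_real x)) / \<alpha>\<^sup>2] q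
        * q powr (2 * (of_real x)\<^sup>2 - of_real x) * \<alpha> powr (4 * of_real x))"

end

theory Submission
  imports Defs "HOL-Probability.Distributions"
begin

text \<open>
  The sum \<open>\<Psi>\<^sub>m\<^sub>,\<^sub>n(\<beta>)\<close> is a linear functional, applied to the product of two Laurent polynomials in \<open>z\<close> and
  evaluated along the points \<open>z = q\<^sup>k \<beta>\<close>. The polynomials depend only on \<open>x = (z - 1/z) / 2\<close>, so their product is
  invariant under \<open>z \<mapsto> -1/z\<close>. On invariant functions the functional factors: its value is the theta series \<open>\<Theta>(\<beta>)\<close>,
  the sum of \<open>q\<close> to the power \<open>j (j - 1) / 2\<close> times \<open>\<beta>\<^sup>2\<^sup>j\<close> over all integers \<open>j\<close>, times a functional that does not depend
  on \<open>\<beta>\<close> (\<open>psi_moment_symmetric\<close>). The reason is that the weight \<open>1 + q\<^sup>2\<^sup>k \<beta>\<^sup>2\<close> distributes an even power of \<open>z\<close> over the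
  even and the odd terms of the theta series with two constants, and \<open>z \<mapsto> -1/z\<close> exchanges these constants, while an
  odd power and its image cancel.
  The remaining formal functional sends \<open>z\<^sup>2\<^sup>s\<close> to \<open>q\<close> to the power \<open>- s (s - 1) / 2\<close>. By the q-binomial theorem to the
  base \<open>1/q\<close>, it pairs the \<open>n\<close>-th polynomial with a power of \<open>z\<close> to an explicit product, which vanishes for all
  exponents that occur in a polynomial of degree at most \<open>n\<close>, except \<open>-n\<close> (\<open>formal_moment_qinv_Hermite_orthogonal\<close>). The Jacobi triple
  product, obtained from the same q-binomial theorem by Tannery's theorem, evaluates \<open>\<Theta>\<close>.

  For the integrals, the weight \<open>q\<close> to the power \<open>2 x\<^sup>2 - x\<close> times \<open>\<alpha>\<^sup>4\<^sup>x\<close> is chosen such that the integrand at \<open>x + k\<close> is the \<open>k\<close>-th term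
  of \<open>\<Psi>\<close> at \<open>q\<^sup>x \<alpha>\<close>. Cutting the line at the integers therefore folds the integral over \<open>\<real>\<close> into the integral of \<open>\<Psi>\<close>
  over the unit interval (\<open>integral_periodization\<close>), where the first part applies pointwise. The case \<open>m = n = 0\<close>
  represents \<open>J\<close> as an integral over \<open>\<real>\<close> of two Gaussians whose quadratic coefficient \<open>-2 log q\<close> is complex with
  positive real part. Their value (\<open>complex_gaussian_integral\<close>) follows from the real Gaussian moments by
  power series expansion: in the quadratic coefficient around a suitable real one, and then in the linear one.
\<close>

section \<open>Gaussian integrals with complex parameters\<close>

text \<open>
  The scaling \<open>\<sigma> = 1 / sqrt (2 a)\<close> turns the known moments of the normal density into this form. The
  Pochhammer symbol \<open>(1/2)\<^sub>k\<close> stands for \<open>(2k)! / (4\<^sup>k k!)\<close>; it makes the moments the coefficients of a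
  binomial series below.
\<close>
lemma gaussian_even_moment:
  fixes a :: real
  assumes a: "a > 0"
  shows "has_bochner_integral lborel (\<lambda>x. exp (- (a * x\<^sup>2)) * x ^ (2 * k))
           (sqrt (pi / a) * pochhammer (1 / 2) k / a ^ k)"
proof -
  define \<sigma> where "\<sigma> = 1 / sqrt (2 * a)"
  have \<sigma>: "\<sigma> > 0" "\<sigma>\<^sup>2 = 1 / (2 * a)"
    using a by (auto simp: \<sigma>_def power_divide)
  have "has_bochner_integral lborel (\<lambda>x. sqrt (pi / a) * (normal_density 0 \<sigma> x * (x - 0) ^ (2 * k)))
          (sqrt (pi / a) * (fact (2 * k) / ((2 / \<sigma>\<^sup>2) ^ k * fact k)))"
    by (intro has_bochner_integral_mult_right normal_moment_even \<sigma>)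
  moreover have "(\<lambda>x. sqrt (pi / a) * (normal_density 0 \<sigma> x * (x - 0) ^ (2 * k))) =
                 (\<lambda>x. exp (- (a * x\<^sup>2)) * x ^ (2 * k))"
    using a unfolding normal_density_def \<sigma>
    by (simp add: real_sqrt_divide real_sqrt_mult field_simps)
  moreover have "fact (2 * k) / ((2 / \<sigma>\<^sup>2) ^ k * fact k) = pochhammer (1 / 2) k / a ^ k"
    using a unfolding \<sigma>
    by (simp add: fact_double[of k, where 'a = real] power_mult_distrib power_mult divide_simps)
  ultimately show ?thesis
    by (simp only: times_divide_eq_right)
qed

text \<open>
  Completing the square bounds the exponent by a constant minus \<open>a x\<^sup>2 / 2\<close>.
\<close>
lemma integrable_gaussian_abs_exp:
  fixes a c :: real
  assumes a: "a > 0"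
  shows "integrable lborel (\<lambda>x. exp (c * \<bar>x\<bar> - a * x\<^sup>2))"
proof (rule Bochner_Integration.integrable_bound)
  show "integrable lborel (\<lambda>x. exp (c\<^sup>2 / (2 * a)) * exp (- (a / 2 * x\<^sup>2)))"
    using gaussian_even_moment[of "a / 2" 0] a
    by (intro integrable_mult_right) (auto simp: has_bochner_integral_iff)
  show "AE x in lborel. norm (exp (c * \<bar>x\<bar> - a * x\<^sup>2)) \<le>
          norm (exp (c\<^sup>2 / (2 * a)) * exp (- (a / 2 * x\<^sup>2)))"
  proof (intro AE_I2)
    fix x :: real
    have "0 \<le> a / 2 * (\<bar>x\<bar> - c / a)\<^sup>2"
      using a by simp
    also have "\<dots> = a / 2 * x\<^sup>2 - c * \<bar>x\<bar> + c\<^sup>2 / (2 * a)"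
      using a by (simp add: power2_eq_square field_simps)
    finally show "norm (exp (c * \<bar>x\<bar> - a * x\<^sup>2)) \<le> norm (exp (c\<^sup>2 / (2 * a)) * exp (- (a / 2 * x\<^sup>2)))"
      by (simp add: mult_exp_exp)
  qed
qed simp

lemma norm_exp_partial_sum_le:
  fixes w :: complex
  shows "norm (\<Sum>k<N. w ^ k / fact k) \<le> exp (norm w)"
proof -
  have "norm (\<Sum>k<N. w ^ k / fact k) \<le> (\<Sum>k<N. norm w ^ k / fact k)"
    by (rule sum_norm_le) (simp add: norm_divide norm_power)
  also have "\<dots> \<le> exp (norm w)"
    using sum_le_suminf[OF summable_exp[of "norm w"], of "{..<N}"]
    by (simp add: exp_def divide_inverse mult.commute)
  finally show ?thesis .
qed

lemma exp_partial_sums_tendsto: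
  fixes w :: complex
  shows "(\<lambda>N. \<Sum>k<N. w ^ k / fact k) \<longlonglongrightarrow> exp w"
  using exp_converges[of w]
  by (simp add: sums_def scaleR_conv_of_real divide_inverse mult.commute)

text \<open>
  The partial sums of \<open>exp w\<close> are bounded by \<open>exp |w|\<close>, so dominated convergence allows termwise integration
  as soon as \<open>exp |w| |g|\<close> is integrable. Both parameters of the complex Gaussian, the quadratic and the linear one,
  are introduced by this expansion.
\<close>
lemma integral_exp_mult_sums:
  fixes w g :: "real \<Rightarrow> complex"
  assumes [measurable]: "w \<in> borel_measurable borel" "g \<in> borel_measurable borel"
  assumes int: "integrable lborel (\<lambda>x. exp (norm (w x)) * norm (g x))"
  shows "integrable lborel (\<lambda>x. exp (w x) * g x)"
    and "integrable lborel (\<lambda>x. w x ^ k * g x)"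
    and "(\<lambda>k. (LINT x|lborel. w x ^ k * g x) / fact k) sums (LINT x|lborel. exp (w x) * g x)"
proof -
  have lim: "AE x in lborel. (\<lambda>N. (\<Sum>k<N. w x ^ k / fact k) * g x) \<longlonglongrightarrow> exp (w x) * g x"
    by (intro AE_I2 tendsto_mult exp_partial_sums_tendsto tendsto_const)
  have bnd: "AE x in lborel. norm ((\<Sum>k<N. w x ^ k / fact k) * g x) \<le> exp (norm (w x)) * norm (g x)" for N
    by (intro AE_I2) (simp only: norm_mult mult_right_mono norm_exp_partial_sum_le norm_ge_zero)
  show "integrable lborel (\<lambda>x. exp (w x) * g x)"
    by (rule integrable_dominated_convergence[OF _ _ int lim bnd]) measurable
  have "integrable lborel (\<lambda>x. w x ^ k / fact k * g x)" for k
  proof (rule Bochner_Integration.integrable_bound[OF int])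
    have "norm (w x) ^ k / fact k \<le> exp (norm (w x))" for x
      using exp_ge_zero sum_le_suminf[OF summable_exp[of "norm (w x)"], of "{k}"]
      by (simp add: exp_def divide_inverse mult.commute)
    hence "norm (w x) ^ k / fact k * norm (g x) \<le> exp (norm (w x)) * norm (g x)" for x
      by (intro mult_right_mono) auto
    thus "AE x in lborel. norm (w x ^ k / fact k * g x) \<le> norm (exp (norm (w x)) * norm (g x))"
      by (intro AE_I2) (simp add: norm_mult norm_divide norm_power)
  qed measurable
  hence "integrable lborel (\<lambda>x. fact k * (w x ^ k / fact k * g x))" for k
    by (intro integrable_mult_right)
  hence ik: "integrable lborel (\<lambda>x. w x ^ k * g x)" for k
    by simp
  show "integrable lborel (\<lambda>x. w x ^ k * g x)"
    by (rule ik)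
  have "(\<lambda>N. LINT x|lborel. (\<Sum>k<N. w x ^ k / fact k) * g x) \<longlonglongrightarrow> (LINT x|lborel. exp (w x) * g x)"
    by (rule integral_dominated_convergence[OF _ _ int lim bnd]) measurable
  also have "(\<lambda>N. LINT x|lborel. (\<Sum>k<N. w x ^ k / fact k) * g x) =
             (\<lambda>N. \<Sum>k<N. (LINT x|lborel. w x ^ k * g x) / fact k)"
  proof
    fix N
    have "(LINT x|lborel. (\<Sum>k<N. w x ^ k / fact k) * g x) =
          (LINT x|lborel. (\<Sum>k<N. (w x ^ k * g x) / fact k))"
      by (simp add: sum_distrib_right)
    also have "\<dots> = (\<Sum>k<N. (LINT x|lborel. w x ^ k * g x) / fact k)"
      using ik by (subst Bochner_Integration.integral_sum) auto
    finally show "(LINT x|lborel. (\<Sum>k<N. w x ^ k / fact k) * g x) =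
             (\<Sum>k<N. (LINT x|lborel. w x ^ k * g x) / fact k)" .
  qed
  finally show "(\<lambda>k. (LINT x|lborel. w x ^ k * g x) / fact k) sums (LINT x|lborel. exp (w x) * g x)"
    by (simp add: sums_def)
qed

text \<open>
  For real parameters this is the classical moment. For complex \<open>A\<close>, choose a real \<open>a\<close> with \<open>|a - A| < a\<close> and expand
  \<open>exp (-A x\<^sup>2) = exp (-a x\<^sup>2) exp ((a - A) x\<^sup>2)\<close> in powers of \<open>h = a - A\<close>. The real moments make the integrated series the
  binomial series of \<open>(1 - h / a)\<close> to the power \<open>-1/2 - j\<close>, and \<open>1 - h / a = A / a\<close>. Keeping \<open>j\<close> general
  costs nothing and provides the moments needed for the linear term.
\<close>
lemma complex_gaussian_even_moment:
  fixes A :: complex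
  assumes A: "Re A > 0"
  shows "(LINT x|lborel. exp (- (A * of_real (x\<^sup>2))) * of_real x ^ (2 * j)) =
           of_real (sqrt pi * pochhammer (1 / 2) j) * A powr (- (1 / 2)) / A ^ j"
proof -
  have A0: "A \<noteq> 0" using A by auto
  \<comment> \<open>With \<open>a = |A|\<^sup>2 / Re A\<close> one has \<open>|a - A|\<^sup>2 = a\<^sup>2 - |A|\<^sup>2\<close>.\<close>
  obtain a :: real where a: "a > 0" "norm (of_real a - A) < a"
  proof -
    define a where "a = (norm A)\<^sup>2 / Re A"
    have "a > 0" using A A0 by (simp add: a_def)
    have "(norm (of_real a - A))\<^sup>2 = a\<^sup>2 - 2 * a * Re A + (norm A)\<^sup>2"
      by (simp add: cmod_power2) (simp add: power2_eq_square algebra_simps)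
    also have "2 * a * Re A = 2 * (norm A)\<^sup>2" using A by (simp add: a_def)
    also have "a\<^sup>2 - 2 * (norm A)\<^sup>2 + (norm A)\<^sup>2 < a\<^sup>2" using A0 by simp
    finally have "norm (of_real a - A) < a"
      using \<open>a > 0\<close> by (simp add: power_less_imp_less_base)
    with \<open>a > 0\<close> show ?thesis using that by blast
  qed
  define h where "h = of_real a - A"
  define m where "m i = sqrt (pi / a) * pochhammer (1 / 2) i / a ^ i" for i :: nat
  define g where "g x = complex_of_real (exp (- (a * x\<^sup>2)) * x ^ (2 * j))" for x
  have [measurable]: "g \<in> borel_measurable borel"
    unfolding g_def by measurable
  have h: "norm h < a" using a by (simp add: h_def)
  have "integrable lborel (\<lambda>x. exp (norm (h * of_real (x\<^sup>2))) * norm (g x))"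
  proof -
    have "integrable lborel (\<lambda>x. exp (- ((a - norm h) * x\<^sup>2)) * x ^ (2 * j))"
      using gaussian_even_moment[of "a - norm h" j] h by (simp add: has_bochner_integral_iff)
    also have "(\<lambda>x. exp (- ((a - norm h) * x\<^sup>2)) * x ^ (2 * j)) =
               (\<lambda>x. exp (norm (h * of_real (x\<^sup>2))) * norm (g x))"
    proof
      fix x :: real
      have "norm (g x) = exp (- (a * x\<^sup>2)) * x ^ (2 * j)"
        by (simp add: g_def norm_mult norm_power power_even_abs)
      thus "exp (- ((a - norm h) * x\<^sup>2)) * x ^ (2 * j) = exp (norm (h * of_real (x\<^sup>2))) * norm (g x)"
        by (simp add: norm_mult norm_power mult_exp_exp algebra_simps flip: mult.assoc)
    qed
    finally show ?thesis .
  qed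
  from integral_exp_mult_sums(3)[OF _ _ this]
  have "(\<lambda>k. (LINT x|lborel. (h * of_real (x\<^sup>2)) ^ k * g x) / fact k) sums
          (LINT x|lborel. exp (h * of_real (x\<^sup>2)) * g x)"
    by simp
  also have "(LINT x|lborel. exp (h * of_real (x\<^sup>2)) * g x) =
             (LINT x|lborel. exp (- (A * of_real (x\<^sup>2))) * of_real x ^ (2 * j))"
    by (simp add: g_def h_def flip: exp_of_real mult.assoc exp_add) (simp add: algebra_simps)
  also have "(\<lambda>k. (LINT x|lborel. (h * of_real (x\<^sup>2)) ^ k * g x) / fact k) =
        (\<lambda>k. of_real (m j) * (((- (1 / 2) - of_nat j) gchoose k) * (- (h / of_real a)) ^ k))"
  proof
    fix k
    have gb: "((- (1 / 2) - of_nat j :: complex) gchoose k) =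
                (-1) ^ k * pochhammer (1 / 2 + of_nat j) k / fact k"
    proof -
      have "- (- (1 / 2) - of_nat j) = (1 / 2 + of_nat j :: complex)" by simp
      thus ?thesis by (simp only: gbinomial_pochhammer)
    qed
    have sign: "(-1) ^ k * ((-1) ^ k * y) = y" for y :: complex
      by (simp flip: mult.assoc power_mult_distrib)
    have "(LINT x|lborel. (h * of_real (x\<^sup>2)) ^ k * g x) =
          (LINT x|lborel. h ^ k * of_real (exp (- (a * x\<^sup>2)) * x ^ (2 * (j + k))))"
      by (simp add: g_def power_mult_distrib power_add distrib_left mult_ac flip: power_mult)
    also have "\<dots> = h ^ k * of_real (m (j + k))"
      using gaussian_even_moment[OF a(1), of "j + k"]
      by (simp add: has_bochner_integral_iff m_def del: of_real_mult)
    also have "m (j + k) = m j * (pochhammer (1 / 2 + of_nat j) k / a ^ k)"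
      by (simp add: m_def pochhammer_product' power_add)
    also have "complex_of_real \<dots> = of_real (m j) * (pochhammer (1 / 2 + of_nat j) k / of_real a ^ k)"
      by (simp flip: pochhammer_of_real)
    also have "h ^ k * (of_real (m j) * (pochhammer (1 / 2 + of_nat j) k / of_real a ^ k)) / fact k =
        of_real (m j) * (((- (1 / 2) - of_nat j) gchoose k) * (- (h / of_real a)) ^ k)"
      unfolding gb using a by (simp add: power_minus[of "h / _"] power_divide sign mult_ac)
    finally show "(LINT x|lborel. (h * of_real (x\<^sup>2)) ^ k * g x) / fact k =
        of_real (m j) * (((- (1 / 2) - of_nat j) gchoose k) * (- (h / of_real a)) ^ k)" .
  qed
  finally have 1: "(\<lambda>k. of_real (m j) * (((- (1 / 2) - of_nat j) gchoose k) * (- (h / of_real a)) ^ k)) sums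
      (LINT x|lborel. exp (- (A * of_real (x\<^sup>2))) * of_real x ^ (2 * j))" .
  have 2: "(\<lambda>k. of_real (m j) * (((- (1 / 2) - of_nat j) gchoose k) * (- (h / of_real a)) ^ k)) sums
      (of_real (m j) * (1 + - (h / of_real a)) powr (- (1 / 2) - of_nat j))"
    using h a by (intro sums_mult gen_binomial_complex) (simp add: norm_divide)
  have e: "1 + - (h / of_real a) = of_real (1 / a) * A"
    using a by (simp add: h_def field_simps)
  have "(of_real (1 / a) * A) powr (- (1 / 2) - of_nat j) =
        of_real (1 / a) powr (- (1 / 2) - of_nat j) * A powr (- (1 / 2) - of_nat j)"
    using a by (subst powr_times_real_left) auto
  also have "of_real (1 / a) powr (- (1 / 2) - complex_of_nat j) = of_real (sqrt a * a ^ j)"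
  proof -
    have "of_real (1 / a) powr (- (1 / 2) - complex_of_nat j) = of_real ((1 / a) powr (- (1 / 2) - real j))"
      using a by (subst powr_of_real[symmetric]) auto
    also have "(1 / a) powr (- (1 / 2) - real j) = sqrt a * a ^ j"
    proof -
      have "(1 / a) powr (- (1 / 2) - real j) = a powr (1 / 2 + real j)"
        using a by (simp add: powr_divide powr_minus_divide[symmetric] add.commute)
      thus ?thesis
        using a by (simp add: powr_add powr_realpow powr_half_sqrt)
    qed
    finally show ?thesis .
  qed
  also have "A powr (- (1 / 2) - of_nat j) = A powr (- (1 / 2)) / A ^ j"
    using A0 by (simp add: powr_diff powr_nat)
  finally have 3: "(of_real (1 / a) * A) powr (- (1 / 2) - of_nat j) =
                   of_real (sqrt a * a ^ j) * (A powr (- (1 / 2)) / A ^ j)" .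
  have "m j * (sqrt a * a ^ j) = sqrt pi * pochhammer (1 / 2) j"
    using a by (simp add: m_def real_sqrt_divide)
  hence 4: "of_real (m j) * (of_real (sqrt a * a ^ j) * (A powr (- (1 / 2)) / A ^ j)) =
            of_real (sqrt pi * pochhammer (1 / 2) j) * A powr (- (1 / 2)) / A ^ j"
    by (metis mult.assoc of_real_mult times_divide_eq_right)
  show ?thesis
    using sums_unique2[OF 1 2] unfolding e 3 4 .
qed

text \<open>
  Expand in powers of \<open>B x\<close>: the odd terms vanish by symmetry and the even moments leave the exponential series of
  \<open>B\<^sup>2 / (4 A)\<close>. This replaces the usual shift of the contour.
\<close>
lemma complex_gaussian_integral:
  fixes A B :: complex
  assumes A: "Re A > 0"
  shows "integrable lborel (\<lambda>x. exp (B * of_real x - A * of_real (x\<^sup>2)))" (is ?int)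
    and "(LINT x|lborel. exp (B * of_real x - A * of_real (x\<^sup>2))) =
           of_real (sqrt pi) * A powr (- (1 / 2)) * exp (B\<^sup>2 / (4 * A))" (is ?eq)
proof -
  have A0: "A \<noteq> 0" using A by auto
  define g where "g x = exp (- (A * of_real (x\<^sup>2)))" for x :: real
  define C where "C = of_real (sqrt pi) * A powr (- (1 / 2))"
  have [measurable]: "g \<in> borel_measurable borel"
    unfolding g_def by measurable
  have "integrable lborel (\<lambda>x. exp (norm (B * of_real x)) * norm (g x))"
  proof -
    have "integrable lborel (\<lambda>x. exp (norm B * \<bar>x\<bar> - Re A * x\<^sup>2))"
      by (rule integrable_gaussian_abs_exp) fact
    also have "(\<lambda>x. exp (norm B * \<bar>x\<bar> - Re A * x\<^sup>2)) = (\<lambda>x. exp (norm (B * of_real x)) * norm (g x))"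
      by (simp add: g_def norm_mult mult_exp_exp flip: of_real_power)
    finally show ?thesis .
  qed
  note * = integral_exp_mult_sums[OF _ _ this, simplified]
  have eq: "exp (B * of_real x) * g x = exp (B * of_real x - A * of_real (x\<^sup>2))" for x
    by (simp add: g_def mult_exp_exp)
  show ?int using *(1) by (simp add: eq)
  have "(\<lambda>k. (LINT x|lborel. (B * of_real x) ^ k * g x) / fact k) sums
          (LINT x|lborel. exp (B * of_real x - A * of_real (x\<^sup>2)))"
    using *(3) by (simp add: eq)
  moreover have "(LINT x|lborel. (B * of_real x) ^ k * g x) = 0" if "odd k" for k
  proof -
    have "(LINT x|lborel. (B * of_real x) ^ k * g x) =
          (LINT x|lborel. (B * of_real (0 + -1 * x)) ^ k * g (0 + -1 * x))"
      by (subst lborel_integral_real_affine[where c = "-1" and t = 0]) simp_all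
    also have "\<dots> = - (LINT x|lborel. (B * of_real x) ^ k * g x)"
      using that by (simp add: g_def flip: Bochner_Integration.integral_minus)
    finally show ?thesis by simp
  qed
  ultimately have "(\<lambda>k. (LINT x|lborel. (B * of_real x) ^ (2 * k) * g x) / fact (2 * k)) sums
          (LINT x|lborel. exp (B * of_real x - A * of_real (x\<^sup>2)))"
    by (subst sums_mono_reindex[of "\<lambda>k. 2 * k"])
       (auto simp: strict_mono_def elim!: evenE) 
  moreover have "(LINT x|lborel. (B * of_real x) ^ (2 * k) * g x) / fact (2 * k) =
                 C * ((B\<^sup>2 / (4 * A)) ^ k / fact k)" for k
  proof -
    have "(LINT x|lborel. (B * of_real x) ^ (2 * k) * g x) =
          (LINT x|lborel. B ^ (2 * k) * (g x * of_real x ^ (2 * k)))"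
      by (simp add: power_mult_distrib mult_ac)
    also have "\<dots> = B ^ (2 * k) * (LINT x|lborel. g x * of_real x ^ (2 * k))"
      by (rule integral_mult_right_zero)
    also have "\<dots> = B ^ (2 * k) * (of_real (sqrt pi * pochhammer (1 / 2) k) * A powr (- (1 / 2)) / A ^ k)"
      unfolding g_def by (subst complex_gaussian_even_moment[OF A]) simp
    also have "\<dots> / fact (2 * k) = C * ((B\<^sup>2 / (4 * A)) ^ k / fact k)"
    proof -
      have "pochhammer (1 / 2 :: real) k \<noteq> 0"
        using pochhammer_pos[of "1 / 2 :: real" k] by simp
      moreover from this have "pochhammer (1 / 2 :: complex) k \<noteq> 0"
        using pochhammer_of_real[of "1 / 2" k, where 'a = complex] by simp
      moreover have "complex_of_real (pochhammer (1 / 2) k) = pochhammer (1 / 2) k"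
        using pochhammer_of_real[of "1 / 2" k, where 'a = complex] by simp
      ultimately show ?thesis
        using A0 by (simp add: C_def fact_double power_mult_distrib power_mult power_divide divide_simps)
    qed
    finally show ?thesis .
  qed
  ultimately have "(\<lambda>k. C * ((B\<^sup>2 / (4 * A)) ^ k / fact k)) sums
          (LINT x|lborel. exp (B * of_real x - A * of_real (x\<^sup>2)))"
    by simp
  moreover have "(\<lambda>k. C * ((B\<^sup>2 / (4 * A)) ^ k / fact k)) sums (C * exp (B\<^sup>2 / (4 * A)))"
    using exp_partial_sums_tendsto[of "B\<^sup>2 / (4 * A)"] by (intro sums_mult) (simp add: sums_def)
  ultimately show ?eq
    using sums_unique2 unfolding C_def by blast
qed

section \<open>The q-binomial theorem\<close>

text \<open>
  Induction with the q-Pascal rule \<open>[n+1, k+1] = [n, k+1] + p\<^sup>n\<^sup>-\<^sup>k [n, k]\<close>. The only condition on the base is that the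
  q-factorials do not vanish, so the theorem applies both to \<open>p = q\<close> (for the triple product) and to \<open>p = 1/q\<close>
  (for the polynomials).
\<close>
lemma q_binomial_theorem:
  fixes p x :: complex
  assumes nz: "\<And>k. qpoch p p k \<noteq> 0"
  shows "(\<Prod>i<n. 1 + x * p ^ i) =
           (\<Sum>k\<le>n. qpoch p p n / (qpoch p p k * qpoch p p (n - k)) * p ^ (k choose 2) * x ^ k)"
proof (induction n)
  case 0
  show ?case by (simp add: qpoch_def numeral_2_eq_2)
next
  case (Suc n)
  define G where "G n k = qpoch p p n / (qpoch p p k * qpoch p p (n - k))" for n k
  have rec: "qpoch p p (Suc k) = qpoch p p k * (1 - p ^ Suc k)" for k
    by (simp add: qpoch_def)
  have nz': "1 - p ^ Suc k \<noteq> 0" for k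
    using nz[of "Suc k"] unfolding rec by auto
  have choose: "Suc k choose 2 = k + (k choose 2)" for k
    by (simp add: numeral_2_eq_2)
  have G0: "G n 0 = 1" for n
    using nz[of n] by (simp add: G_def qpoch_def[of _ _ 0])
  have Gn: "G n n = 1" for n
    using nz[of n] by (simp add: G_def qpoch_def[of _ _ 0])
  have pascal: "G (Suc n) (Suc k) = G n (Suc k) + p ^ (n - k) * G n k" if k: "k < n" for k
  proof -
    obtain d where d: "n = Suc (k + d)"
      using k less_iff_Suc_add by auto
    have "G (Suc n) (Suc k) * (qpoch p p (Suc k) * qpoch p p (Suc d)) = qpoch p p (Suc n)"
      using nz by (simp add: G_def d)
    moreover have "G n (Suc k) * (qpoch p p (Suc k) * qpoch p p (Suc d)) = qpoch p p n * (1 - p ^ Suc d)"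
      using nz by (simp add: G_def d rec[of d])
    moreover have "G n k * (qpoch p p (Suc k) * qpoch p p (Suc d)) = qpoch p p n * (1 - p ^ Suc k)"
      using nz by (simp add: G_def d rec[of k])
    moreover have "qpoch p p (Suc n) = qpoch p p n * (1 - p ^ Suc d) + p ^ (n - k) * (qpoch p p n * (1 - p ^ Suc k))"
      unfolding rec[of n] by (simp add: d algebra_simps power_add)
    ultimately have "G (Suc n) (Suc k) * (qpoch p p (Suc k) * qpoch p p (Suc d)) =
        G n (Suc k) * (qpoch p p (Suc k) * qpoch p p (Suc d)) +
        p ^ (n - k) * (G n k * (qpoch p p (Suc k) * qpoch p p (Suc d)))"
      by (simp only:)
    hence "G (Suc n) (Suc k) * (qpoch p p (Suc k) * qpoch p p (Suc d)) =
        (G n (Suc k) + p ^ (n - k) * G n k) * (qpoch p p (Suc k) * qpoch p p (Suc d))"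
      by (simp only: distrib_right mult.assoc)
    thus ?thesis using nz by simp
  qed
  have c: "G (Suc n) (Suc k) * p ^ (Suc k choose 2) * x ^ Suc k =
        G n (Suc k) * p ^ (Suc k choose 2) * x ^ Suc k + x * p ^ n * (G n k * p ^ (k choose 2) * x ^ k)"
    if "k < n" for k
  proof -
    have "p ^ (n - k) * p ^ (Suc k choose 2) = p ^ n * p ^ (k choose 2)"
      using that by (simp add: choose flip: power_add)
    thus ?thesis
      unfolding pascal[OF that] by (simp add: algebra_simps)
  qed
  have last: "G (Suc n) (Suc n) * p ^ (Suc n choose 2) * x ^ Suc n =
              x * p ^ n * (G n n * p ^ (n choose 2) * x ^ n)"
    by (simp add: Gn choose power_add)
  have "(\<Sum>k\<le>Suc n. G (Suc n) k * p ^ (k choose 2) * x ^ k) =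
        1 + (\<Sum>k\<le>n. G (Suc n) (Suc k) * p ^ (Suc k choose 2) * x ^ Suc k)"
    by (subst sum.atMost_Suc_shift) (simp add: G0 numeral_2_eq_2)
  also have "(\<Sum>k\<le>n. G (Suc n) (Suc k) * p ^ (Suc k choose 2) * x ^ Suc k) =
      (\<Sum>k<n. G (Suc n) (Suc k) * p ^ (Suc k choose 2) * x ^ Suc k) +
      G (Suc n) (Suc n) * p ^ (Suc n choose 2) * x ^ Suc n"
    by (simp add: lessThan_Suc_atMost[symmetric])
  also have "\<dots> = (\<Sum>k<n. G n (Suc k) * p ^ (Suc k choose 2) * x ^ Suc k) +
      ((\<Sum>k<n. x * p ^ n * (G n k * p ^ (k choose 2) * x ^ k)) +
       x * p ^ n * (G n n * p ^ (n choose 2) * x ^ n))"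
    unfolding last by (simp add: c sum.distrib del: power_Suc)
  also have "(\<Sum>k<n. x * p ^ n * (G n k * p ^ (k choose 2) * x ^ k)) +
       x * p ^ n * (G n n * p ^ (n choose 2) * x ^ n) =
       x * p ^ n * (\<Sum>k\<le>n. G n k * p ^ (k choose 2) * x ^ k)"
    by (simp add: lessThan_Suc_atMost[symmetric] sum_distrib_left algebra_simps)
  also have "1 + ((\<Sum>k<n. G n (Suc k) * p ^ (Suc k choose 2) * x ^ Suc k) + \<dots>) =
        (1 + x * p ^ n) * (\<Sum>k\<le>n. G n k * p ^ (k choose 2) * x ^ k)"
  proof -
    have "1 + (\<Sum>k<n. G n (Suc k) * p ^ (Suc k choose 2) * x ^ Suc k) =
          (\<Sum>k\<le>n. G n k * p ^ (k choose 2) * x ^ k)"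
      unfolding lessThan_Suc_atMost[symmetric]
      by (subst sum.lessThan_Suc_shift) (simp add: G0 numeral_2_eq_2)
    thus ?thesis by (simp add: algebra_simps)
  qed
  also have "(\<Sum>k\<le>n. G n k * p ^ (k choose 2) * x ^ k) = (\<Prod>i<n. 1 + x * p ^ i)"
    unfolding Suc.IH G_def ..
  finally show ?case
    unfolding G_def by (simp add: mult.commute)
qed

section \<open>Theta series and the Jacobi triple product\<close>

text \<open>
  The binomial coefficient \<open>j choose 2\<close> for arbitrary integers \<open>j\<close>, so that theta series can be indexed by all of
  \<open>\<int>\<close>.
\<close>
definition int_choose2 :: "int \<Rightarrow> int" where
  "int_choose2 j = j * (j - 1) div 2"

lemma two_int_choose2: "2 * int_choose2 j = j * (j - 1)"
  unfolding int_choose2_def by simp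

lemma int_choose2_of_nat: "int_choose2 (int k) = int (k choose 2)"
proof -
  have "2 * int (k choose 2) = int k * (int k - 1)"
  proof (induction k)
    case (Suc k)
    have "Suc k choose 2 = k + (k choose 2)" by (simp add: numeral_2_eq_2)
    thus ?case using Suc by (simp add: algebra_simps)
  qed (simp add: numeral_2_eq_2)
  thus ?thesis using two_int_choose2[of "int k"] by simp
qed

definition theta_term :: "complex \<Rightarrow> complex \<Rightarrow> int \<Rightarrow> complex" where
  "theta_term q z j = q powi int_choose2 j * z powi j"

lemma theta_term_nat_summable:
  assumes q: "0 < norm q" "norm q < 1" and z: "z \<noteq> 0"
  shows "summable (\<lambda>k. norm (theta_term q z (int k)))"
proof -
  have "(\<lambda>k. norm q ^ k * norm z) \<longlonglongrightarrow> 0 * norm z"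
    using q by (intro tendsto_intros LIMSEQ_power_zero) auto
  hence "eventually (\<lambda>k. norm q ^ k * norm z < 1 / 2) sequentially"
    by (rule order_tendstoD) auto
  then obtain N where N: "\<And>k. k \<ge> N \<Longrightarrow> norm q ^ k * norm z < 1 / 2"
    unfolding eventually_sequentially by auto
  show ?thesis
  proof (rule summable_ratio_test[of "1 / 2" N])
    fix k assume k: "k \<ge> N"
    have "Suc k choose 2 = k + (k choose 2)" by (simp add: numeral_2_eq_2)
    hence "norm (theta_term q z (int (Suc k))) = (norm q ^ k * norm z) * norm (theta_term q z (int k))"
      unfolding theta_term_def int_choose2_of_nat power_int_of_nat
      by (simp add: norm_mult norm_power power_add)
    also have "\<dots> \<le> 1 / 2 * norm (theta_term q z (int k))"
      using N[OF k] by (intro mult_right_mono) auto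
    finally show "norm (norm (theta_term q z (int (Suc k)))) \<le> 1 / 2 * norm (norm (theta_term q z (int k)))"
      by simp
  qed simp
qed

text \<open>
  This reduces the summability over the negative integers to that over the natural numbers.
\<close>
lemma theta_term_neg:
  assumes "q \<noteq> 0" "z \<noteq> 0"
  shows "theta_term q z (- j) = theta_term q (q / z) j"
proof -
  have "int_choose2 (- j) = int_choose2 j + j"
    using two_int_choose2[of j] two_int_choose2[of "-j"] by (simp add: algebra_simps)
  thus ?thesis
    using assms by (simp add: theta_term_def power_int_add power_int_minus power_int_divide_distrib field_simps)
qed

lemma theta_term_abs_summable:
  assumes q: "0 < norm q" "norm q < 1" and z: "z \<noteq> 0"
  shows "(\<lambda>j. norm (theta_term q z j)) summable_on UNIV"
proof -
  have *: "(\<lambda>j. norm (theta_term q z j)) summable_on (int ` UNIV)" if "z \<noteq> 0" for z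
    using theta_term_nat_summable[OF q that]
    by (subst summable_on_reindex) (auto simp: o_def intro!: norm_summable_imp_summable_on)
  have "(\<lambda>j. norm (theta_term q z j)) summable_on (uminus ` (int ` UNIV))"
    using *[of "q / z"] q z
    by (subst summable_on_reindex) (auto simp: o_def theta_term_neg inj_on_def)
  from summable_on_union[OF *[OF z] this]
  have "(\<lambda>j. norm (theta_term q z j)) summable_on (int ` UNIV \<union> uminus ` int ` UNIV)" .
  also have "int ` UNIV \<union> uminus ` int ` UNIV = UNIV"
  proof -
    have "x \<in> range int \<or> x \<in> uminus ` range int" for x
      by (cases x rule: int_cases2) auto
    thus ?thesis by auto
  qed
  finally show ?thesis .
qed

lemma qpoch_tendsto:
  assumes "norm q < 1"
  shows "(\<lambda>n. qpoch y q n) \<longlonglongrightarrow> qpoch_inf y q"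
proof -
  have "(\<lambda>n. \<Prod>i\<le>n. 1 - y * q ^ i) \<longlonglongrightarrow> qpoch_inf y q"
    unfolding qpoch_inf_def by (intro convergent_prod_LIMSEQ convergent_prod_qpoch_inf assms)
  thus ?thesis
    unfolding qpoch_def by (simp add: LIMSEQ_lessThan_iff_atMost)
qed

lemma qpoch_inf_self_nonzero:
  assumes "norm q < 1"
  shows "qpoch_inf q q \<noteq> 0"
proof -
  have "1 - q * q ^ j \<noteq> 0" for j
    using qpoch_self_nonzero[OF assms, of "Suc j"] by (simp add: qpoch_def)
  thus ?thesis
    unfolding qpoch_inf_def using convergent_prod_qpoch_inf[OF assms] by (intro prodinf_nonzero)
qed

text \<open>
  The q-binomial theorem with \<open>2 N\<close> factors and \<open>x = z q\<^sup>-\<^sup>N\<close>: the upper \<open>N\<close> factors form \<open>(-z; q)\<^sub>N\<close>, and pulling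
  \<open>z q\<^sup>-\<^sup>i\<^sup>-\<^sup>1\<close> out of each of the lower ones leaves \<open>(-q/z; q)\<^sub>N\<close>. The index \<open>k\<close> becomes \<open>N + j\<close>.
\<close>
lemma finite_triple_product:
  fixes q z :: complex
  assumes q: "0 < norm q" "norm q < 1" and z: "z \<noteq> 0"
  shows "qpoch (- z) q N * qpoch (- (q / z)) q N =
           (\<Sum>j\<in>{- int N..int N}. qpoch q q (2 * N) / (qpoch q q (nat (int N + j)) * qpoch q q (nat (int N - j)))
              * theta_term q z j)"
proof -
  have q0: "q \<noteq> 0" using q by auto
  \<comment> \<open>The product of the factors that are pulled out of the lower half.\<close>
  define c where "c = z ^ N * q powi (- int_choose2 (- int N))"
  have c0: "c \<noteq> 0" using q0 z by (simp add: c_def)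
  define x where "x = z * q powi (- int N)"
  define G where "G k = qpoch q q (2 * N) / (qpoch q q k * qpoch q q (2 * N - k))" for k
  have "(\<Prod>i<2 * N. 1 + x * q ^ i) = (\<Prod>i<N. 1 + x * q ^ i) * (\<Prod>i<N. 1 + x * q ^ (N + i))"
  proof -
    have "(\<Prod>i<N + M. 1 + x * q ^ i) = (\<Prod>i<N. 1 + x * q ^ i) * (\<Prod>i<M. 1 + x * q ^ (N + i))" for M
      by (induction M) (simp_all add: mult_ac)
    from this[of N] show ?thesis by (simp add: mult_2)
  qed
  also have "(\<Prod>i<N. 1 + x * q ^ (N + i)) = qpoch (- z) q N"
    using q0 by (simp add: qpoch_def x_def power_add power_int_minus field_simps)
  also have "(\<Prod>i<N. 1 + x * q ^ i) = (\<Prod>i<N. 1 + x * q ^ (N - Suc i))"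
    by (rule prod.nat_diff_reindex[symmetric])
  also have "\<dots> = (\<Prod>i<N. (z * q powi (- int (Suc i))) * (1 + q / z * q ^ i))"
  proof (intro prod.cong refl)
    fix i assume i: "i \<in> {..<N}"
    have "q powi (- int N) * q ^ (N - Suc i) = q powi (- int (Suc i))"
    proof -
      have "q powi (- int N) * q ^ (N - Suc i) = q powi (- int N + int (N - Suc i))"
        by (simp only: power_int_add[OF disjI1[OF q0]] power_int_of_nat)
      also have "- int N + int (N - Suc i) = - int (Suc i)" using i by auto
      finally show ?thesis .
    qed
    hence "1 + x * q ^ (N - Suc i) = 1 + z * q powi (- int (Suc i))"
      by (simp add: x_def mult.assoc)
    also have "\<dots> = (z * q powi (- int (Suc i))) * (1 + q / z * q ^ i)"
    proof -
      have "q powi (- int (Suc i)) * q ^ Suc i = 1"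
        using q0 by (simp only: power_int_minus power_int_of_nat)
          (rule left_inverse, simp)
      moreover have "(z * P) * (1 + q / z * q ^ i) = z * P + P * q ^ Suc i" for P
        using z by (simp add: field_simps)
      ultimately show ?thesis by simp
    qed
    finally show "1 + x * q ^ (N - Suc i) = (z * q powi (- int (Suc i))) * (1 + q / z * q ^ i)" .
  qed
  also have "\<dots> = (\<Prod>i<N. z * q powi (- int (Suc i))) * qpoch (- (q / z)) q N"
    by (simp add: prod.distrib qpoch_def)
  also have "(\<Prod>i<N. z * q powi (- int (Suc i))) = c"
  proof -
    have "(\<Prod>i<M. z * q powi (- int (Suc i))) = z ^ M * q powi (- int_choose2 (- int M))" for M
    proof (induction M)
      case 0
      show ?case by (simp add: int_choose2_def)
    next
      case (Suc M)
      have "- int_choose2 (- int (Suc M)) = - int_choose2 (- int M) + (- int (Suc M))"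
        using two_int_choose2[of "- int M"] two_int_choose2[of "- int (Suc M)"] by (simp add: algebra_simps)
      hence "z ^ Suc M * q powi (- int_choose2 (- int (Suc M))) =
             (z ^ M * q powi (- int_choose2 (- int M))) * (z * q powi (- int (Suc M)))"
        by (simp only: power_int_add[OF disjI1[OF q0]] power_Suc mult_ac)
      thus ?case
        using Suc by (simp only: prod.lessThan_Suc)
    qed
    thus ?thesis unfolding c_def .
  qed
  finally have prod_eq: "(\<Prod>i<2 * N. 1 + x * q ^ i) = c * (qpoch (- z) q N * qpoch (- (q / z)) q N)"
    by (simp add: mult_ac)
  have "(\<Prod>i<2 * N. 1 + x * q ^ i) = (\<Sum>k\<le>2 * N. G k * q ^ (k choose 2) * x ^ k)"
    unfolding G_def by (rule q_binomial_theorem) (rule qpoch_self_nonzero[OF q(2)])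
  also have "\<dots> = (\<Sum>j\<in>{- int N..int N}. G (nat (int N + j)) * q ^ (nat (int N + j) choose 2) * x ^ nat (int N + j))"
    by (rule sum.reindex_bij_witness[of _ "\<lambda>j. nat (int N + j)" "\<lambda>k. int k - int N"]) auto
  also have "\<dots> = (\<Sum>j\<in>{- int N..int N}. c * (qpoch q q (2 * N) /
       (qpoch q q (nat (int N + j)) * qpoch q q (nat (int N - j))) * theta_term q z j))"
  proof (intro sum.cong refl)
    fix j assume j: "j \<in> {- int N..int N}"
    define k where "k = nat (int N + j)"
    have k: "int k = int N + j" using j by (simp add: k_def)
    have k': "2 * N - k = nat (int N - j)" using j k by arith
    have "q ^ (k choose 2) * x ^ k = q powi int_choose2 (int k) * (z powi int k * q powi (- int N * int k))"
      unfolding x_def int_choose2_of_nat power_int_mult[of q "- int N"] power_int_of_nat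
      by (simp only: power_mult_distrib)
    also have "\<dots> = q powi (int_choose2 (int k) + - int N * int k) * z powi int k"
      by (simp only: power_int_add[OF disjI1[OF q0]] mult_ac)
    also have "int_choose2 (int k) + - int N * int k = int_choose2 j + - int_choose2 (- int N)"
      using two_int_choose2[of "int k"] two_int_choose2[of j] two_int_choose2[of "- int N"]
      unfolding k by (simp add: algebra_simps)
    also have "q powi (int_choose2 j + - int_choose2 (- int N)) * z powi int k = c * theta_term q z j"
      unfolding k c_def theta_term_def power_int_add[OF disjI1[OF q0]] power_int_add[OF disjI1[OF z]]
        power_int_of_nat by (simp only: mult_ac)
    finally have "q ^ (k choose 2) * x ^ k = c * theta_term q z j" .
    thus "G (nat (int N + j)) * q ^ (nat (int N + j) choose 2) * x ^ nat (int N + j) =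
      c * (qpoch q q (2 * N) / (qpoch q q (nat (int N + j)) * qpoch q q (nat (int N - j))) * theta_term q z j)"
      unfolding k_def[symmetric] G_def k' by (simp add: mult.assoc)
  qed
  finally show ?thesis
    using c0 unfolding prod_eq sum_distrib_left[symmetric] by simp
qed

text \<open>
  Enumerating \<open>\<int>\<close> by the natural numbers makes the theorems on ordinary series (Tannery's theorem, termwise integration)
  available for bilateral sums.
\<close>
lemma infsum_int_suminf:
  fixes f :: "int \<Rightarrow> 'a::banach"
  assumes "(\<lambda>j. norm (f j)) summable_on UNIV"
  shows "summable (\<lambda>k. norm (f (int_decode k)))" and "(\<Sum>k. f (int_decode k)) = infsum f UNIV"
proof -
  have "(\<lambda>k. norm (f (int_decode k))) summable_on UNIV"
    by (rule iffD2[OF summable_on_reindex_bij_betw[OF bij_int_decode, of "\<lambda>j. norm (f j)"] assms])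
  thus "summable (\<lambda>k. norm (f (int_decode k)))"
    by (rule summable_on_imp_summable)
  have "(f has_sum infsum f UNIV) UNIV"
    by (rule has_sum_infsum[OF abs_summable_summable[OF assms]])
  hence "((\<lambda>k. f (int_decode k)) has_sum infsum f UNIV) UNIV"
    by (rule iffD2[OF has_sum_reindex_bij_betw[OF bij_int_decode, of f "infsum f UNIV"]])
  from sums_unique[OF has_sum_imp_sums[OF this], symmetric]
  show "(\<Sum>k. f (int_decode k)) = infsum f UNIV" .
qed

text \<open>
  Let \<open>N\<close> tend to infinity in the finite version. Each coefficient tends to \<open>1 / (q; q)\<^sub>\<infinity>\<close>, and since the q-factorials and
  their inverses are bounded, Tannery's theorem applies.
\<close>
theorem jacobi_triple_product:
  assumes q: "0 < norm q" "norm q < 1" and z: "z \<noteq> 0"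
  shows "infsum (theta_term q z) UNIV = qpoch_inf q q * qpoch_inf (- z) q * qpoch_inf (- (q / z)) q"
proof -
  define u where "u j N = (if \<bar>j\<bar> \<le> int N then
      qpoch q q (2 * N) / (qpoch q q (nat (int N + j)) * qpoch q q (nat (int N - j))) * theta_term q z j else 0)"
    for j and N :: nat
  have lim0: "(\<lambda>n. qpoch q q n) \<longlonglongrightarrow> qpoch_inf q q"
    by (rule qpoch_tendsto) fact
  have nz: "qpoch_inf q q \<noteq> 0"
    by (rule qpoch_inf_self_nonzero) fact
  have "convergent (\<lambda>n. qpoch q q n)" "convergent (\<lambda>n. inverse (qpoch q q n))"
    using lim0 tendsto_inverse[OF lim0 nz] by (auto simp: convergent_def)
  then obtain U V where UV: "U > 0" "V > 0" "\<And>n. norm (qpoch q q n) \<le> U" "\<And>n. norm (inverse (qpoch q q n)) \<le> V"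
    by (meson Bseq_def convergent_imp_Bseq)
  have bound: "norm (u j N) \<le> U * V * V * norm (theta_term q z j)" for j N
  proof (cases "\<bar>j\<bar> \<le> int N")
    case True
    have "norm (u j N) = norm (qpoch q q (2 * N)) * norm (inverse (qpoch q q (nat (int N + j)))) *
             norm (inverse (qpoch q q (nat (int N - j)))) * norm (theta_term q z j)"
      using True by (simp add: u_def norm_mult norm_divide norm_inverse divide_inverse)
    also have "\<dots> \<le> U * V * V * norm (theta_term q z j)"
      using UV by (intro mult_mono mult_nonneg_nonneg) (auto intro: less_imp_le)
    finally show ?thesis .
  qed (use UV in \<open>simp add: u_def\<close>)
  have lim: "(\<lambda>N. u j N) \<longlonglongrightarrow> theta_term q z j / qpoch_inf q q" for j
  proof -
    have f: "filterlim (\<lambda>N. nat (int N + i)) sequentially sequentially" for i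
    proof (subst filterlim_at_top, intro allI)
      fix M
      show "eventually (\<lambda>N. M \<le> nat (int N + i)) sequentially"
        using eventually_ge_at_top[of "M + nat \<bar>i\<bar>"] by eventually_elim auto
    qed
    have f2: "filterlim (\<lambda>N::nat. 2 * N) sequentially sequentially"
      by (rule filterlim_subseq) (auto simp: strict_mono_def)
    have "(\<lambda>N. qpoch q q (2 * N) / (qpoch q q (nat (int N + j)) * qpoch q q (nat (int N - j))) * theta_term q z j)
            \<longlonglongrightarrow> qpoch_inf q q / (qpoch_inf q q * qpoch_inf q q) * theta_term q z j"
      using filterlim_compose[OF lim0 f[of j]] filterlim_compose[OF lim0 f[of "-j"]]
        filterlim_compose[OF lim0 f2] nz by (intro tendsto_intros) auto
    moreover have "eventually (\<lambda>N. qpoch q q (2 * N) / (qpoch q q (nat (int N + j)) *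
        qpoch q q (nat (int N - j))) * theta_term q z j = u j N) sequentially"
      using eventually_ge_at_top[of "nat \<bar>j\<bar>"] by eventually_elim (auto simp: u_def)
    ultimately have "(\<lambda>N. u j N) \<longlonglongrightarrow> qpoch_inf q q / (qpoch_inf q q * qpoch_inf q q) * theta_term q z j"
      by (rule Lim_transform_eventually)
    thus ?thesis using nz by simp
  qed
  have "(\<lambda>N. \<Sum>k. u (int_decode k) N) \<longlonglongrightarrow> (\<Sum>k. theta_term q z (int_decode k) / qpoch_inf q q)"
  proof (rule tannerys_theorem[THEN conjunct2, THEN conjunct2])
    show "eventually (\<lambda>(k, N). norm (u (int_decode k) N) \<le>
            U * V * V * norm (theta_term q z (int_decode k))) (sequentially \<times>\<^sub>F sequentially)"
      using bound by (intro always_eventually) (simp add: case_prod_unfold)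
    show "summable (\<lambda>k. U * V * V * norm (theta_term q z (int_decode k)))"
      by (intro summable_mult infsum_int_suminf(1)[where f = "theta_term q z"] theta_term_abs_summable assms)
    show "(\<lambda>N. u (int_decode k) N) \<longlonglongrightarrow> theta_term q z (int_decode k) / qpoch_inf q q" for k
      by (rule lim)
  qed simp
  also have "(\<Sum>k. theta_term q z (int_decode k) / qpoch_inf q q) = infsum (theta_term q z) UNIV / qpoch_inf q q"
    using infsum_int_suminf[OF theta_term_abs_summable[OF assms]]
    by (subst suminf_divide) (auto intro: summable_norm_cancel)
  also have "(\<lambda>N. \<Sum>k. u (int_decode k) N) = (\<lambda>N. qpoch (- z) q N * qpoch (- (q / z)) q N)"
  proof
    fix N
    have "u j N = 0" if "j \<notin> {- int N..int N}" for j
      using that by (auto simp: u_def)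
    hence *: "((\<lambda>j. u j N) has_sum (\<Sum>j\<in>{- int N..int N}. u j N)) UNIV"
      by (intro has_sum_finite_neutralI) auto
    have "((\<lambda>k. u (int_decode k) N) has_sum (\<Sum>j\<in>{- int N..int N}. u j N)) UNIV"
      by (rule iffD2[OF has_sum_reindex_bij_betw[OF bij_int_decode, of "\<lambda>j. u j N"] *])
    from has_sum_imp_sums[OF this] have "(\<Sum>k. u (int_decode k) N) = (\<Sum>j\<in>{- int N..int N}. u j N)"
      by (simp add: sums_iff)
    also have "\<dots> = qpoch (- z) q N * qpoch (- (q / z)) q N"
      unfolding finite_triple_product[OF assms] by (intro sum.cong) (auto simp: u_def)
    finally show "(\<Sum>k. u (int_decode k) N) = qpoch (- z) q N * qpoch (- (q / z)) q N" .
  qed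
  finally have "(\<lambda>N. qpoch (- z) q N * qpoch (- (q / z)) q N) \<longlonglongrightarrow> infsum (theta_term q z) UNIV / qpoch_inf q q" .
  moreover have "(\<lambda>N. qpoch (- z) q N * qpoch (- (q / z)) q N) \<longlonglongrightarrow> qpoch_inf (- z) q * qpoch_inf (- (q / z)) q"
    by (intro tendsto_mult qpoch_tendsto q)
  ultimately have "infsum (theta_term q z) UNIV / qpoch_inf q q = qpoch_inf (- z) q * qpoch_inf (- (q / z)) q"
    by (rule LIMSEQ_unique)
  thus ?thesis using nz by (simp add: field_simps)
qed

section \<open>The polynomials as orthogonal Laurent polynomials\<close>

text \<open>
  The coefficient of \<open>z\<^sup>n\<^sup>-\<^sup>2\<^sup>k\<close> in the \<open>n\<close>-th polynomial. Writing it with Gaussian binomials to the base \<open>1/q\<close> makes the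
  q-binomial theorem directly applicable.
\<close>
definition qinv_coeff :: "complex \<Rightarrow> nat \<Rightarrow> nat \<Rightarrow> complex" where
  "qinv_coeff q n k = (-1) ^ k * (qpoch (inverse q) (inverse q) n /
     (qpoch (inverse q) (inverse q) k * qpoch (inverse q) (inverse q) (n - k)))"

lemma qinv_Hermite_Laurent:
  assumes z: "z \<noteq> 0"
  shows "qinv_Hermite n z q = (\<Sum>k\<le>n. qinv_coeff q n k * z powi (int n - 2 * int k))"
proof -
  have "inverse (\<i> ^ n) * (\<i> * z) powi (int n - 2 * int k) = (-1) ^ k * z powi (int n - 2 * int k)" for k
  proof -
    have "\<i> powi (int n - 2 * int k) = \<i> ^ n / (\<i>\<^sup>2) ^ k"
      by (simp add: power_int_diff power_int_mult)
    also have "\<dots> = \<i> ^ n * (-1) ^ k"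
      by (cases "even k") auto
    finally show ?thesis
      by (simp add: power_int_mult_distrib)
  qed
  hence *: "inverse (\<i> ^ n) * (G * (\<i> * z) powi (int n - 2 * int k)) =
             ((-1) ^ k * G) * z powi (int n - 2 * int k)" for k G
    by (simp add: mult.left_commute mult.assoc)
  show ?thesis
    unfolding qinv_Hermite_def cont_q_Hermite_def sum_distrib_left qinv_coeff_def * ..
qed

text \<open>
  This is the invariance of the polynomials under \<open>z \<mapsto> -1/z\<close>, which fixes \<open>x = (z - 1/z) / 2\<close>.
\<close>
lemma qinv_coeff_reflect:
  assumes "k \<le> n"
  shows "qinv_coeff q n (n - k) = (-1) ^ n * qinv_coeff q n k"
proof -
  have "(-1::complex) ^ (n - k) = (-1) ^ n * (-1) ^ k"
    using assms by (simp add: minus_one_power_iff)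
  thus ?thesis
    using assms by (simp add: qinv_coeff_def mult_ac)
qed

lemma qpoch_inverse_self_nonzero:
  assumes q: "0 < norm q" "norm q < 1"
  shows "qpoch (inverse q) (inverse q) k \<noteq> 0"
  using qpoch_inverse_self[of q k] qpoch_self_nonzero[OF q(2), of k] q by auto

text \<open>
  The functional on Laurent polynomials that sends \<open>z\<^sup>2\<^sup>s\<close> to \<open>q\<close> to the power \<open>- s (s - 1) / 2\<close> and odd powers of \<open>z\<close> to \<open>0\<close>.
  On Laurent polynomials invariant under \<open>z \<mapsto> -1/z\<close>, the bilateral sum is this functional times the theta series; in
  contrast to the bilateral sum, it does not depend on the base point.
\<close>
definition formal_moment :: "complex \<Rightarrow> int \<Rightarrow> complex" where
  "formal_moment q p = (if even p then q powi (- int_choose2 (p div 2)) else 0)"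

text \<open>
  Expanding \<open>(s - k) choose 2\<close> in \<open>k\<close> turns the sum into the q-binomial theorem to the base \<open>1/q\<close>, so the pairing of a
  polynomial with a power \<open>z\<^sup>j\<close> is an explicit product.
\<close>
lemma formal_moment_qinv_Hermite:
  assumes q: "0 < norm q" "norm q < 1" and s: "int n + j = 2 * s"
  shows "(\<Sum>k\<le>n. qinv_coeff q n k * formal_moment q (int n - 2 * int k + j)) =
           q powi (- int_choose2 s) * (\<Prod>i<n. 1 - inverse q powi (1 - s + int i))"
proof -
  have q0: "q \<noteq> 0" using q by auto
  define p where "p = inverse q"
  have p0: "p \<noteq> 0" using q0 by (simp add: p_def)
  have "(\<Prod>i<n. 1 - p powi (1 - s + int i)) = (\<Prod>i<n. 1 + (- (p powi (1 - s))) * p ^ i)"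
    by (simp only: power_int_add[OF disjI1[OF p0]] power_int_of_nat) simp
  also have "\<dots> = (\<Sum>k\<le>n. qpoch p p n / (qpoch p p k * qpoch p p (n - k)) * p ^ (k choose 2) *
                     (- (p powi (1 - s))) ^ k)"
    by (rule q_binomial_theorem) (unfold p_def, rule qpoch_inverse_self_nonzero[OF q])
  finally have eq: "(\<Prod>i<n. 1 - p powi (1 - s + int i)) = \<dots>" .
  show ?thesis
    unfolding p_def[symmetric] eq sum_distrib_left
  proof (intro sum.cong refl)
    fix k
    have "int n - 2 * int k + j = 2 * (s - int k)" using s by simp
    hence "formal_moment q (int n - 2 * int k + j) = q powi (- int_choose2 (s - int k))"
      by (simp only: formal_moment_def) simp
    also have "- int_choose2 (s - int k) = - int_choose2 s + - int_choose2 (int k) + - (1 - s) * int k"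
      using two_int_choose2[of "s - int k"] two_int_choose2[of s] two_int_choose2[of "int k"]
      by (simp add: algebra_simps)
    also have "q powi \<dots> = q powi (- int_choose2 s) * (p ^ (k choose 2) * (p powi (1 - s)) ^ k)"
    proof -
      have "q powi (- int_choose2 (int k)) = p ^ (k choose 2)"
        by (simp add: int_choose2_of_nat p_def power_int_minus power_inverse)
      moreover have "q powi (- (1 - s) * int k) = (p powi (1 - s)) ^ k"
        unfolding power_int_mult power_int_of_nat p_def
        by (simp only: power_int_minus power_int_inverse)
      ultimately show ?thesis
        by (simp only: power_int_add[OF disjI1[OF q0]] mult.assoc)
    qed
    finally show "qinv_coeff q n k * formal_moment q (int n - 2 * int k + j) =
        q powi (- int_choose2 s) * (qpoch p p n / (qpoch p p k * qpoch p p (n - k)) * p ^ (k choose 2) *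
          (- (p powi (1 - s))) ^ k)"
      by (simp add: qinv_coeff_def p_def power_minus[of "_ powi _"] mult_ac)
  qed
qed

text \<open>
  For even \<open>n + j = 2 s\<close> the hypotheses say \<open>1 \<le> s \<le> n\<close>, and then the factor with \<open>i = s - 1\<close> is zero. For odd
  \<open>n + j\<close> every term vanishes.
\<close>
lemma formal_moment_qinv_Hermite_eq_0:
  assumes q: "0 < norm q" "norm q < 1" and j: "- int n < j" "j < int n + 2"
  shows "(\<Sum>k\<le>n. qinv_coeff q n k * formal_moment q (int n - 2 * int k + j)) = 0"
proof (cases "even (int n + j)")
  case True
  then obtain s where s: "int n + j = 2 * s" by (elim evenE)
  have "nat (s - 1) < n" "1 - s + int (nat (s - 1)) = 0"
    using s j by auto
  hence "(\<Prod>i<n. 1 - inverse q powi (1 - s + int i)) = 0"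
    by (intro prod_zero bexI[of _ "nat (s - 1)"]) auto
  thus ?thesis
    unfolding formal_moment_qinv_Hermite[OF q s] by simp
next
  case False
  hence "odd (int n - 2 * int k + j)" for k by simp
  thus ?thesis by (simp add: formal_moment_def)
qed

text \<open>
  The exponents \<open>j = m - 2 l\<close> of the polynomial of degree \<open>m \<le> n\<close> lie between \<open>-m\<close> and \<open>m\<close>, so the previous lemma
  annihilates all of them except \<open>j = -n\<close>, which occurs only for \<open>m = n\<close> and contributes the norm.
\<close>
lemma formal_moment_qinv_Hermite_orthogonal:
  assumes q: "0 < norm q" "norm q < 1" and mn: "m \<le> n"
  shows "(\<Sum>l\<le>m. \<Sum>k\<le>n. qinv_coeff q m l * qinv_coeff q n k *
            formal_moment q (int n - 2 * int k + (int m - 2 * int l))) =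
         q powi (- int (n choose 2)) * qpoch q q n / q ^ n * (if m = n then 1 else 0)"
proof -
  have q0: "q \<noteq> 0" using q by auto
  define S where "S j = (\<Sum>k\<le>n. qinv_coeff q n k * formal_moment q (int n - 2 * int k + j))" for j
  have "(\<Sum>l\<le>m. \<Sum>k\<le>n. qinv_coeff q m l * qinv_coeff q n k *
            formal_moment q (int n - 2 * int k + (int m - 2 * int l))) =
        (\<Sum>l\<le>m. qinv_coeff q m l * S (int m - 2 * int l))"
    by (simp add: S_def sum_distrib_left mult.assoc)
  also have "\<dots> = q powi (- int (n choose 2)) * qpoch q q n / q ^ n * (if m = n then 1 else 0)"
  proof (cases "m = n")
    case False
    hence "S (int m - 2 * int l) = 0" if "l \<le> m" for l
      unfolding S_def using mn that by (intro formal_moment_qinv_Hermite_eq_0[OF q]) auto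
    with False show ?thesis by simp
  next
    case True
    have "S (int m - 2 * int l) = 0" if "l < m" for l
      unfolding S_def using mn that by (intro formal_moment_qinv_Hermite_eq_0[OF q]) (auto simp: True)
    hence "(\<Sum>l\<le>m. qinv_coeff q m l * S (int m - 2 * int l)) = qinv_coeff q n n * S (- int n)"
      by (simp add: lessThan_Suc_atMost[symmetric] True)
    also have "S (- int n) = qpoch (inverse q) (inverse q) n"
      unfolding S_def using formal_moment_qinv_Hermite[OF q, of n "- int n" 0] q0
      by (simp add: int_choose2_def qpoch_def power_int_add)
    also have "qinv_coeff q n n = (-1) ^ n"
      using qpoch_inverse_self_nonzero[OF q, of n] by (simp add: qinv_coeff_def qpoch_def[of _ _ 0])
    also have "(-1) ^ n * qpoch (inverse q) (inverse q) n =
               q powi (- int (n choose 2)) * qpoch q q n / q ^ n"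
    proof -
      have "(-1) ^ n * (qpoch (inverse q) (inverse q) n * q ^ (n choose 2) * q ^ n) = qpoch q q n"
        unfolding qpoch_inverse_self[OF q0] by (simp flip: mult.assoc power_mult_distrib)
      thus ?thesis using q0 by (simp add: power_int_minus field_simps)
    qed
    finally show ?thesis by (simp add: True)
  qed
  finally show ?thesis .
qed

section \<open>From the formal functional to the bilateral sum\<close>

text \<open>
  Up to a constant, the terms are those of a theta series to the base \<open>q\<^sup>4\<close>.
\<close>
lemma quadratic_exponent_summable:
  fixes q b :: complex
  assumes q: "0 < norm q" "norm q < 1" and b: "b \<noteq> 0"
  shows "(\<lambda>k::int. q powi (2 * k\<^sup>2 + r * k) * b powi (4 * k + s)) summable_on UNIV"
proof -
  have q0: "q \<noteq> 0" using q by auto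
  have "0 < norm (q ^ 4)"
    using q0 by simp
  moreover have "norm (q ^ 4) < 1"
    unfolding norm_power using q by (intro power_less_one_iff[THEN iffD2]) auto
  moreover have "q powi (r + 2) * b ^ 4 \<noteq> 0"
    using q0 b by simp
  ultimately have "theta_term (q ^ 4) (q powi (r + 2) * b ^ 4) summable_on UNIV"
    by (rule abs_summable_summable[OF theta_term_abs_summable])
  hence "(\<lambda>k. b powi s * theta_term (q ^ 4) (q powi (r + 2) * b ^ 4) k) summable_on UNIV"
    by (rule summable_on_cmult_right)
  also have "(\<lambda>k. b powi s * theta_term (q ^ 4) (q powi (r + 2) * b ^ 4) k) =
             (\<lambda>k::int. q powi (2 * k\<^sup>2 + r * k) * b powi (4 * k + s))"
  proof
    fix k :: int
    have "theta_term (q ^ 4) (q powi (r + 2) * b ^ 4) k =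
            (q powi 4) powi int_choose2 k * ((q powi (r + 2)) powi k * (b powi 4) powi k)"
      by (simp add: theta_term_def power_int_mult_distrib)
    also have "\<dots> = q powi (4 * int_choose2 k + (r + 2) * k) * b powi (4 * k)"
      by (simp only: power_int_mult[symmetric] mult.assoc
            power_int_add[OF disjI1[OF q0], of "4 * int_choose2 k" "(r + 2) * k"])
    also have "4 * int_choose2 k + (r + 2) * k = 2 * k\<^sup>2 + r * k"
      using two_int_choose2[of k] by (simp add: power2_eq_square algebra_simps)
    finally show "b powi s * theta_term (q ^ 4) (q powi (r + 2) * b ^ 4) k =
                  q powi (2 * k\<^sup>2 + r * k) * b powi (4 * k + s)"
      by (simp only: power_int_add[OF disjI1[OF b]] mult_ac)
  qed
  finally show ?thesis .
qed

definition psi_weight :: "complex \<Rightarrow> complex \<Rightarrow> int \<Rightarrow> complex" where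
  "psi_weight q b k = (1 + q powi (2 * k) * b\<^sup>2) * q powi (2 * k\<^sup>2 - k) * b powi (4 * k)"

lemma psi_weight_mult_powi:
  assumes q0: "q \<noteq> 0" and b: "b \<noteq> 0"
  shows "psi_weight q b k * (q powi k * b) powi p =
           q powi (2 * k\<^sup>2 + (p - 1) * k) * b powi (4 * k + p) +
           q powi (2 * k\<^sup>2 + (p + 1) * k) * b powi (4 * k + (p + 2))"
proof -
  have e: "(q powi k * b) powi p = q powi (k * p) * b powi p" "b\<^sup>2 = b powi 2"
    by (simp_all add: power_int_mult_distrib power_int_mult)
  have 1: "2 * k\<^sup>2 + (p - 1) * k = (2 * k\<^sup>2 - k) + k * p"
    "2 * k\<^sup>2 + (p + 1) * k = 2 * k + (2 * k\<^sup>2 - k) + k * p"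
    "4 * k + (p + 2) = 2 + 4 * k + p"
    by (simp_all add: algebra_simps)
  show ?thesis
    unfolding psi_weight_def e 1 power_int_add[OF disjI1[OF q0]] power_int_add[OF disjI1[OF b]]
    by (simp only: distrib_right distrib_left mult_1_left mult_1_right mult_ac)
qed

text \<open>
  The sum defining \<open>\<Psi>\<close> with the product of the two polynomials replaced by the power \<open>z\<^sup>p\<close> at \<open>z = q\<^sup>k b\<close>.
\<close>
definition psi_moment :: "complex \<Rightarrow> complex \<Rightarrow> int \<Rightarrow> complex" where
  "psi_moment q b p = (\<Sum>\<^sub>\<infinity>k::int. psi_weight q b k * (q powi k * b) powi p)"

lemma psi_moment_summable:
  assumes q: "0 < norm q" "norm q < 1" and b: "b \<noteq> 0"
  shows "(\<lambda>k. psi_weight q b k * (q powi k * b) powi p) summable_on UNIV"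
proof -
  have q0: "q \<noteq> 0" using q by auto
  show ?thesis
    unfolding psi_weight_mult_powi[OF q0 b]
    by (rule summable_on_add[OF quadratic_exponent_summable[OF assms] quadratic_exponent_summable[OF assms]])
qed

lemma psi_moment_split:
  assumes q: "0 < norm q" "norm q < 1" and b: "b \<noteq> 0"
  shows "psi_moment q b p = (\<Sum>\<^sub>\<infinity>k::int. q powi (2 * k\<^sup>2 + (p - 1) * k) * b powi (4 * k + p)) +
           (\<Sum>\<^sub>\<infinity>k::int. q powi (2 * k\<^sup>2 + (p + 1) * k) * b powi (4 * k + (p + 2)))"
proof -
  have q0: "q \<noteq> 0" using q by auto
  show ?thesis
    unfolding psi_moment_def psi_weight_mult_powi[OF q0 b]
    by (rule infsum_add[OF quadratic_exponent_summable[OF assms] quadratic_exponent_summable[OF assms]])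
qed

text \<open>
  The two halves of the weight, from the summands \<open>1\<close> and \<open>q\<^sup>2\<^sup>k b\<^sup>2\<close> of its first factor, are exchanged when \<open>p\<close> is
  replaced by \<open>-p\<close>, up to a shift of the summation index by \<open>r = (p + 1) / 2\<close>, an integer since \<open>p\<close> is odd.
\<close>
lemma psi_moment_odd:
  assumes q: "0 < norm q" "norm q < 1" and b: "b \<noteq> 0" and p: "odd p"
  shows "psi_moment q b (- p) = psi_moment q b p"
proof -
  have shift: "(\<Sum>\<^sub>\<infinity>k::int. q powi (2 * k\<^sup>2 + (p + 1) * k) * b powi (4 * k + (p + 2))) =
        (\<Sum>\<^sub>\<infinity>k::int. q powi (2 * k\<^sup>2 + (- p - 1) * k) * b powi (4 * k + - p))" if "odd p" for p
  proof -
    obtain t where t: "p = 2 * t + 1"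
      using \<open>odd p\<close> by (elim oddE)
    define r where "r = t + 1"
    have r: "p = 2 * r - 1"
      by (simp add: t r_def)
    have *: "2 * (k + r)\<^sup>2 + (- p - 1) * (k + r) = 2 * k\<^sup>2 + (p + 1) * k"
      "4 * (k + r) + - p = 4 * k + (p + 2)" for k
      by (simp_all add: r power2_eq_square algebra_simps)
    show ?thesis
      by (rule infsum_reindex_bij_witness[of _ "\<lambda>k. k - r" "\<lambda>k. k + r"]) (simp_all only: * UNIV_I diff_add_cancel add_diff_cancel)
  qed
  have "odd (- p)" using p by simp
  note s = shift[OF p] shift[OF this, unfolded minus_minus]
  show ?thesis
    unfolding psi_moment_split[OF q b] s by (rule add.commute)
qed

text \<open>
  For \<open>p = 2 s\<close>, each half of the weight gives a constant times the terms of the theta series whose index has a fixed parity.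
  The two constants differ in general, so a single moment need not be a multiple of the full series, but in the symmetric
  combination the even and the odd part occur with equal coefficients.
\<close>
lemma psi_moment_even:
  assumes q: "0 < norm q" "norm q < 1" and b: "b \<noteq> 0"
  shows "psi_moment q b (2 * s) + psi_moment q b (- (2 * s)) =
           (q powi (- int_choose2 s) + q powi (- int_choose2 (- s))) * infsum (theta_term q (b\<^sup>2)) UNIV"
proof -
  have q0: "q \<noteq> 0" using q by auto
  have b2: "b\<^sup>2 \<noteq> 0" using b by simp
  \<comment> \<open>The part of the theta series over the indices congruent to \<open>r\<close> modulo \<open>2\<close>.\<close>
  define U where "U r = (\<Sum>\<^sub>\<infinity>k::int. theta_term q (b\<^sup>2) (2 * k + r))" for r
  have bpow: "b powi (4 * k + 2 * r) = (b\<^sup>2) powi (2 * k + r)" for k r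
  proof -
    have "b powi (4 * k + 2 * r) = b powi (2 * (2 * k + r))" by (simp add: algebra_simps)
    thus ?thesis by (simp only: power_int_mult) simp
  qed
  have 1: "q powi (2 * k\<^sup>2 + (2 * s - 1) * k) * b powi (4 * k + 2 * s) =
           q powi (- int_choose2 s) * theta_term q (b\<^sup>2) (2 * k + s)" for k s
  proof -
    have "2 * k\<^sup>2 + (2 * s - 1) * k = - int_choose2 s + int_choose2 (2 * k + s)"
      using two_int_choose2[of s] two_int_choose2[of "2 * k + s"]
      by (simp add: power2_eq_square algebra_simps)
    thus ?thesis
      by (simp only: bpow theta_term_def power_int_add[OF disjI1[OF q0]] mult.assoc)
  qed
  have 2: "q powi (2 * k\<^sup>2 + (2 * s + 1) * k) * b powi (4 * k + (2 * s + 2)) =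
           q powi (- int_choose2 (- s)) * theta_term q (b\<^sup>2) (2 * k + (1 + s))" for k s
  proof -
    have "2 * k\<^sup>2 + (2 * s + 1) * k = - int_choose2 (- s) + int_choose2 (2 * k + (1 + s))"
      using two_int_choose2[of "- s"] two_int_choose2[of "2 * k + (1 + s)"]
      by (simp add: power2_eq_square algebra_simps)
    moreover have "b powi (4 * k + (2 * s + 2)) = (b\<^sup>2) powi (2 * k + (1 + s))"
      using bpow[of k "1 + s"] by (simp add: algebra_simps)
    ultimately show ?thesis
      by (simp only: theta_term_def power_int_add[OF disjI1[OF q0]] mult.assoc)
  qed
  have L: "psi_moment q b (2 * s) = q powi (- int_choose2 s) * U s + q powi (- int_choose2 (- s)) * U (1 + s)" for s
    unfolding psi_moment_split[OF q b] 1 2 U_def infsum_cmult_right' ..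
  have U: "U s + U (1 - s) = infsum (theta_term q (b\<^sup>2)) UNIV" for s
  proof -
    have sm: "theta_term q (b\<^sup>2) summable_on UNIV"
      by (rule abs_summable_summable[OF theta_term_abs_summable[OF q b2]])
    have "U s = infsum (theta_term q (b\<^sup>2)) {j. even (j - s)}"
      unfolding U_def
    proof (rule infsum_reindex_bij_witness[of _ "\<lambda>j. (j - s) div 2" "\<lambda>k. 2 * k + s"])
      fix j assume "j \<in> {j. even (j - s)}"
      hence "2 * ((j - s) div 2) = j - s"
        using even_two_times_div_two by blast
      thus "2 * ((j - s) div 2) + s = j" by linarith
    qed simp_all
    moreover have "U (1 - s) = infsum (theta_term q (b\<^sup>2)) {j. odd (j - s)}"
      unfolding U_def
    proof (rule infsum_reindex_bij_witness[of _ "\<lambda>j. (j - (1 - s)) div 2" "\<lambda>k. 2 * k + (1 - s)"])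
      fix j assume "j \<in> {j. odd (j - s)}"
      hence "even (j - (1 - s))" by simp
      hence "2 * ((j - (1 - s)) div 2) = j - (1 - s)"
        using even_two_times_div_two by blast
      thus "2 * ((j - (1 - s)) div 2) + (1 - s) = j" by linarith
    qed simp_all
    moreover have "infsum (theta_term q (b\<^sup>2)) ({j. even (j - s)} \<union> {j. odd (j - s)}) =
         infsum (theta_term q (b\<^sup>2)) {j. even (j - s)} + infsum (theta_term q (b\<^sup>2)) {j. odd (j - s)}"
      by (intro infsum_Un_disjoint summable_on_subset_banach[OF sm]) auto
    moreover have "{j. even (j - s)} \<union> {j. odd (j - s)} = UNIV" by blast
    ultimately show ?thesis by simp
  qed
  have "psi_moment q b (2 * s) + psi_moment q b (2 * (- s)) =
        q powi (- int_choose2 s) * (U s + U (1 - s)) + q powi (- int_choose2 (- s)) * (U (- s) + U (1 - (- s)))"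
    unfolding L by (simp add: algebra_simps)
  also have "\<dots> = (q powi (- int_choose2 s) + q powi (- int_choose2 (- s))) * infsum (theta_term q (b\<^sup>2)) UNIV"
    unfolding U by (simp add: algebra_simps)
  finally show ?thesis by simp
qed

text \<open>
  The two parities together: on the symmetrized power \<open>z\<^sup>p + (-1/z)\<^sup>p\<close>, the bilateral sum is the theta series times the
  formal functional.
\<close>
lemma psi_moment_symmetric:
  assumes q: "0 < norm q" "norm q < 1" and b: "b \<noteq> 0"
  shows "psi_moment q b p + (-1) powi p * psi_moment q b (- p) =
           (formal_moment q p + (-1) powi p * formal_moment q (- p)) * infsum (theta_term q (b\<^sup>2)) UNIV"
proof (cases "even p")
  case True
  then obtain s where s: "p = 2 * s" by (elim evenE)
  have "(-1 :: complex) powi p = 1" using True by simp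
  moreover have "- (2 * s) div 2 = - s" by simp
  ultimately show ?thesis
    using psi_moment_even[OF q b, of s] by (simp add: s formal_moment_def)
next
  case False
  hence "(-1 :: complex) powi p = - 1" by simp
  with False show ?thesis
    using psi_moment_odd[OF q b, of p] by (simp add: formal_moment_def)
qed

lemma has_sum_finite_sum:
  fixes f :: "'i \<Rightarrow> 'k \<Rightarrow> complex"
  assumes "finite I" "\<And>i. i \<in> I \<Longrightarrow> (f i has_sum S i) A"
  shows "((\<lambda>k. \<Sum>i\<in>I. f i k) has_sum (\<Sum>i\<in>I. S i)) A"
  using assms by (induction I rule: finite_induct) (auto intro!: has_sum_add)

lemma Psi_has_sum_moments:
  assumes q: "0 < norm q" "norm q < 1" and b: "b \<noteq> 0"
  shows "((\<lambda>k::int. (1 + q powi (2 * k) * b\<^sup>2)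
          * qinv_Hermite n (q powi k * b) q * qinv_Hermite m (q powi k * b) q
          * q powi (2 * k\<^sup>2 - k) * b powi (4 * k)) has_sum
        (\<Sum>l\<le>m. \<Sum>k\<le>n. qinv_coeff q m l * qinv_coeff q n k *
            psi_moment q b (int n - 2 * int k + (int m - 2 * int l)))) UNIV"
proof -
  have q0: "q \<noteq> 0" using q by auto
  have "(1 + q powi (2 * k) * b\<^sup>2) * qinv_Hermite n (q powi k * b) q * qinv_Hermite m (q powi k * b) q
          * q powi (2 * k\<^sup>2 - k) * b powi (4 * k) =
        (\<Sum>l\<le>m. \<Sum>i\<le>n. qinv_coeff q m l * qinv_coeff q n i *
            (psi_weight q b k * (q powi k * b) powi (int n - 2 * int i + (int m - 2 * int l))))" for k
  proof -
    define z where "z = q powi k * b"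
    have z: "z \<noteq> 0" using q0 b by (simp add: z_def)
    have "(1 + q powi (2 * k) * b\<^sup>2) * qinv_Hermite n z q * qinv_Hermite m z q
          * q powi (2 * k\<^sup>2 - k) * b powi (4 * k) =
          (qinv_Hermite m z q * qinv_Hermite n z q) * psi_weight q b k"
      by (simp add: psi_weight_def mult_ac)
    also have "\<dots> = (\<Sum>l\<le>m. \<Sum>i\<le>n. qinv_coeff q m l * qinv_coeff q n i *
            (psi_weight q b k * z powi (int n - 2 * int i + (int m - 2 * int l))))"
      unfolding qinv_Hermite_Laurent[OF z] unfolding sum_product unfolding sum_distrib_right
        power_int_add[OF disjI1[OF z]] by (intro sum.cong refl) (simp only: mult_ac)
    finally show ?thesis unfolding z_def .
  qed
  thus ?thesis
    using psi_moment_summable[OF q b]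
    by (simp only:) (intro has_sum_finite_sum has_sum_cmult_right finite_atMost,
        simp add: psi_moment_def)
qed

text \<open>
  The product of the two polynomials is invariant under \<open>z \<mapsto> -1/z\<close>, hence a combination of symmetrized powers; so \<open>\<Psi>\<close> is the
  theta series times the formal functional, to which the formal orthogonality applies. Since \<open>\<Psi>\<close> is symmetric in \<open>m\<close> and
  \<open>n\<close>, it suffices to treat \<open>m \<le> n\<close>.
\<close>
lemma Psi_eq_theta:
  assumes q: "0 < norm q" "norm q < 1" and b: "b \<noteq> 0"
  shows "Psi m n b q = q powi (- int (n choose 2)) * qpoch q q n / q ^ n * (if m = n then 1 else 0)
           * infsum (theta_term q (b\<^sup>2)) UNIV"
proof -
  have main: "Psi m n b q = q powi (- int (n choose 2)) * qpoch q q n / q ^ n * (if m = n then 1 else 0)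
           * infsum (theta_term q (b\<^sup>2)) UNIV" if mn: "m \<le> n" for m n
  proof -
    define \<Theta> where "\<Theta> = infsum (theta_term q (b\<^sup>2)) UNIV"
    define c where "c l k = qinv_coeff q m l * qinv_coeff q n k" for l k
    define e where "e l k = int n - 2 * int k + (int m - 2 * int l)" for l k
    define S where "S f = (\<Sum>l\<le>m. \<Sum>k\<le>n. c l k * f (e l k))" for f :: "int \<Rightarrow> complex"
    \<comment> \<open>Reversing both summations applies \<open>z \<mapsto> -1/z\<close> to the product of the polynomials.\<close>
    have refl: "S f = (\<Sum>l\<le>m. \<Sum>k\<le>n. c l k * ((-1) powi (e l k) * f (- e l k)))" for f
    proof -
      have flip: "(\<Sum>k\<le>N. g k) = (\<Sum>k\<le>N. g (N - k))" for g :: "nat \<Rightarrow> complex" and N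
        by (rule sum.reindex_bij_witness[of _ "\<lambda>k. N - k" "\<lambda>k. N - k"]) auto
      have "S f = (\<Sum>l\<le>m. \<Sum>k\<le>n. c (m - l) (n - k) * f (e (m - l) (n - k)))"
        unfolding S_def
        by (subst flip) (intro sum.cong refl flip[of "\<lambda>k. c _ k * f (e _ k)"])
      also have "\<dots> = (\<Sum>l\<le>m. \<Sum>k\<le>n. c l k * ((-1) powi (e l k) * f (- e l k)))"
      proof (intro sum.cong refl)
        fix l k assume lk: "l \<in> {..m}" "k \<in> {..n}"
        have "e (m - l) (n - k) = - e l k" using lk by (auto simp: e_def)
        moreover have "c (m - l) (n - k) = c l k * (-1) powi (e l k)"
        proof -
          have "(-1 :: complex) powi (e l k) = (-1) ^ n * (-1) ^ m"
            by (simp add: e_def power_int_minus_left minus_one_power_iff)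
          thus ?thesis using lk by (simp add: c_def qinv_coeff_reflect)
        qed
        ultimately show "c (m - l) (n - k) * f (e (m - l) (n - k)) = c l k * ((-1) powi (e l k) * f (- e l k))"
          by simp
      qed
      finally show ?thesis .
    qed
    have two: "2 * S f = (\<Sum>l\<le>m. \<Sum>k\<le>n. c l k * (f (e l k) + (-1) powi (e l k) * f (- e l k)))" for f
    proof -
      have "2 * S f = S f + S f" by simp
      also have "\<dots> = (\<Sum>l\<le>m. \<Sum>k\<le>n. c l k * f (e l k)) + (\<Sum>l\<le>m. \<Sum>k\<le>n. c l k * ((-1) powi (e l k) * f (- e l k)))"
        by (subst refl) (simp only: S_def add.commute)
      finally show ?thesis by (simp only: sum.distrib distrib_left)
    qed
    have two_S: "2 * S (psi_moment q b) = 2 * S (formal_moment q) * \<Theta>"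
      unfolding two psi_moment_symmetric[OF q b] \<Theta>_def sum_distrib_right
      by (simp only: mult.assoc)
    have formal: "S (formal_moment q) = q powi (- int (n choose 2)) * qpoch q q n / q ^ n * (if m = n then 1 else 0)"
      unfolding S_def c_def e_def by (rule formal_moment_qinv_Hermite_orthogonal[OF q mn])
    have Psi: "Psi m n b q = S (psi_moment q b)"
      unfolding Psi_def S_def c_def e_def by (rule infsumI[OF Psi_has_sum_moments[OF q b]])
    from two_S have "S (psi_moment q b) = S (formal_moment q) * \<Theta>"
      by simp
    with formal Psi show ?thesis by (simp only: \<Theta>_def)
  qed
  have sym: "Psi m n b q = Psi n m b q"
    unfolding Psi_def by (simp only: mult_ac)
  show ?thesis
    using main[of m n] main[of n m] sym by (cases "m \<le> n") auto
qed

section \<open>Unfolding the integral over the line\<close>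

text \<open>
  The line is the disjoint union of the intervals \<open>[k, k + 1)\<close>. Translating each of them to \<open>[0, 1)\<close> gives the sum of
  integrals, and it may be exchanged with the integral because the integrals of the absolute values add up to at
  most the integral of \<open>|h|\<close>.
\<close>
lemma integral_periodization:
  fixes h :: "real \<Rightarrow> complex"
  assumes h: "integrable lborel h"
  assumes sm: "\<And>x. (\<lambda>k::int. h (x + of_int k)) summable_on UNIV"
  shows "set_integrable lborel {0..1} (\<lambda>x. \<Sum>\<^sub>\<infinity>k::int. h (x + of_int k))"
    and "(LINT x:{0..1}|lborel. \<Sum>\<^sub>\<infinity>k::int. h (x + of_int k)) = (LINT x|lborel. h x)"
proof -
  \<comment> \<open>\<open>g i\<close> is \<open>h\<close> cut down to the \<open>i\<close>-th interval, and \<open>f i\<close> is its translate to \<open>[0, 1)\<close>.\<close>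
  define d where "d i = real_of_int (int_decode i)" for i
  define g where "g i x = indicator {d i..<d i + 1} x *\<^sub>R h x" for i x
  define f where "f i x = indicator {0..<1} x *\<^sub>R h (x + d i)" for i and x :: real
  define F where "F x = (\<Sum>\<^sub>\<infinity>k::int. h (x + of_int k))" for x
  have [measurable]: "h \<in> borel_measurable borel"
    using h by auto
  have fg: "f i x = g i (d i + 1 * x)" for i x
    by (simp add: f_def g_def indicator_def add.commute)
  have int_g: "integrable lborel (g i)" for i
    unfolding g_def using h by (intro integrable_mult_indicator) auto
  have int_f: "integrable lborel (f i)" for i
    using lborel_integrable_real_affine[OF int_g[of i], of 1 "d i"] by (simp add: fg[abs_def])
  have integral_fg: "(LINT x|lborel. f i x) = (LINT x|lborel. g i x)" for i
    using lborel_integral_real_affine[of 1 "g i" "d i"] by (simp add: fg)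
  have norm_fg: "(LINT x|lborel. norm (f i x)) = (LINT x|lborel. norm (g i x))" for i
    using lborel_integral_real_affine[of 1 "\<lambda>x. norm (g i x)" "d i"] by (simp add: fg)
  have ind: "indicator {d i..<d i + 1} y = (if i = int_encode \<lfloor>y\<rfloor> then 1 else (0::real))" for i y
  proof -
    have "y \<in> {d i..<d i + 1} \<longleftrightarrow> \<lfloor>y\<rfloor> = int_decode i"
      by (auto simp: d_def floor_eq_iff)
    also have "\<dots> \<longleftrightarrow> i = int_encode \<lfloor>y\<rfloor>"
      by (metis int_decode_inverse int_encode_inverse)
    finally show ?thesis by (simp add: indicator_def)
  qed
  have g_eq: "g i y = (if i = int_encode \<lfloor>y\<rfloor> then h y else 0)" for i y
    by (simp add: g_def ind)
  have sum_norm_g: "summable (\<lambda>i. LINT x|lborel. norm (g i x))"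
  proof (rule summableI_nonneg_bounded)
    fix N
    have "(\<Sum>i<N. LINT x|lborel. norm (g i x)) = (LINT x|lborel. (\<Sum>i<N. norm (g i x)))"
      using int_g by (subst Bochner_Integration.integral_sum) auto
    also have "\<dots> \<le> (LINT x|lborel. norm (h x))"
    proof (rule integral_mono)
      fix x
      show "(\<Sum>i<N. norm (g i x)) \<le> norm (h x)"
        by (simp add: g_eq if_distrib[of norm] cong: if_cong)
    qed (use int_g h in auto)
    finally show "(\<Sum>i<N. LINT x|lborel. norm (g i x)) \<le> (LINT x|lborel. norm (h x))" .
  qed auto
  have F_sum: "summable (\<lambda>i. norm (f i x))" "(\<Sum>i. f i x) = indicator {0..<1} x *\<^sub>R F x" for x
  proof -
    have "(\<lambda>k::int. norm (h (x + of_int k))) summable_on UNIV"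
      using sm[of x] unfolding summable_on_iff_abs_summable_on_complex .
    note * = infsum_int_suminf[OF this]
    show "summable (\<lambda>i. norm (f i x))"
      using *(1) by (cases "x \<in> {0..<1}") (simp_all add: f_def d_def)
    show "(\<Sum>i. f i x) = indicator {0..<1} x *\<^sub>R F x"
      using *(2) by (cases "x \<in> {0..<1}") (simp_all add: f_def d_def F_def)
  qed
  have f_sum: "integrable lborel (\<lambda>x. \<Sum>i. f i x)"
      "(LINT x|lborel. (\<Sum>i. f i x)) = (\<Sum>i. (LINT x|lborel. f i x))"
    using int_f F_sum(1) sum_norm_g by (auto intro!: integrable_suminf integral_suminf simp: norm_fg)
  \<comment> \<open>Exactly one interval contains \<open>x\<close>, so this series has a single nonzero term.\<close>
  have g_sums: "(\<lambda>i. g i x) sums h x" for x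
    unfolding g_eq by (rule sums_single)
  have "(LINT x|lborel. (\<Sum>i. g i x)) = (\<Sum>i. (LINT x|lborel. g i x))"
  proof (rule integral_suminf[OF int_g _ sum_norm_g])
    have "summable (\<lambda>i. norm (g i x))" for x
      by (rule summable_finite[of "{int_encode \<lfloor>x\<rfloor>}"]) (auto simp: g_eq)
    thus "AE x in lborel. summable (\<lambda>i. norm (g i x))"
      by simp
  qed
  hence total: "(LINT x|lborel. h x) = (LINT x|lborel. indicator {0..<1} x *\<^sub>R F x)"
    using g_sums f_sum(2) unfolding F_sum(2) integral_fg by (simp add: sums_iff)
  \<comment> \<open>The closed interval of the statement differs from the half-open one by the single point \<open>1\<close>.\<close>
  have split: "indicator {0..1} x *\<^sub>R F x = indicator {0..<1} x *\<^sub>R F x + indicator {1} x *\<^sub>R F 1" for x :: real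
    by (auto simp: indicator_def)
  have one: "integrable lborel (\<lambda>x::real. indicator {1} x *\<^sub>R F 1)"
      "(LINT x|lborel. indicator {1::real} x *\<^sub>R F 1) = 0"
    by auto
  show "set_integrable lborel {0..1} F"
    using f_sum(1) one unfolding set_integrable_def split F_sum(2)
    by (intro Bochner_Integration.integrable_add)
  show "(LINT x:{0..1}|lborel. F x) = (LINT x|lborel. h x)"
    using f_sum(1) one unfolding set_lebesgue_integral_def split F_sum(2) total
    by (subst Bochner_Integration.integral_add) auto
qed

text \<open>
  The weight \<open>q\<close> to the power \<open>2 x\<^sup>2 - x\<close> times \<open>\<alpha>\<^sup>4\<^sup>x\<close> is made so that translating \<open>x\<close> by an integer \<open>k\<close> produces exactly the \<open>k\<close>-th
  term of \<open>\<Psi>\<close> at \<open>q\<^sup>x \<alpha>\<close>. This holds for principal powers because translation by an integer only contributes integer powers.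
\<close>
lemma Psi_term_shift:
  fixes q \<alpha> :: complex and k :: int and x :: real
  assumes q0: "q \<noteq> 0" and a0: "\<alpha> \<noteq> 0"
  defines "\<beta> \<equiv> q powr of_real x * \<alpha>"
  shows "(1 + q powr (2 * of_real (x + of_int k)) * \<alpha>\<^sup>2)
          * qinv_Hermite n (q powr of_real (x + of_int k) * \<alpha>) q * qinv_Hermite m (q powr of_real (x + of_int k) * \<alpha>) q
          * q powr (2 * (of_real (x + of_int k))\<^sup>2 - of_real (x + of_int k)) * \<alpha> powr (4 * of_real (x + of_int k)) =
         ((1 + q powi (2 * k) * \<beta>\<^sup>2) * qinv_Hermite n (q powi k * \<beta>) q * qinv_Hermite m (q powi k * \<beta>) q
          * q powi (2 * k\<^sup>2 - k) * \<beta> powi (4 * k)) * (q powr (2 * (of_real x)\<^sup>2 - of_real x) * \<alpha> powr (4 * of_real x))"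
proof -
  define A where "A = Ln \<alpha>"
  define Q where "Q = Ln q"
  have \<alpha>: "\<alpha> powr s = exp (s * A)" for s using a0 by (simp add: powr_def A_def)
  have q: "q powr s = exp (s * Q)" for s using q0 by (simp add: powr_def Q_def)
  have \<alpha>i: "\<alpha> powi j = exp (of_int j * A)" for j
    using a0 by (simp add: A_def flip: exp_power_int)
  have qi: "q powi j = exp (of_int j * Q)" for j
    using q0 by (simp add: Q_def flip: exp_power_int)
  have 1: "q powr of_real (x + of_int k) * \<alpha> = q powi k * \<beta>"
    by (simp add: \<beta>_def q qi distrib_right exp_add)
  have 2: "q powr (2 * of_real (x + of_int k)) * \<alpha>\<^sup>2 = q powi (2 * k) * \<beta>\<^sup>2"
    by (simp add: \<beta>_def q qi power_mult_distrib algebra_simps exp_add flip: exp_double)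
  have 3: "q powr (2 * (of_real (x + of_int k))\<^sup>2 - of_real (x + of_int k)) * \<alpha> powr (4 * of_real (x + of_int k)) =
           q powi (2 * k\<^sup>2 - k) * \<beta> powi (4 * k) * (q powr (2 * (of_real x)\<^sup>2 - of_real x) * \<alpha> powr (4 * of_real x))"
    unfolding \<beta>_def power_int_mult_distrib \<alpha>i qi q \<alpha> exp_power_int mult_exp_exp
    by (rule arg_cong[of _ _ exp]) (simp add: power2_eq_square algebra_simps)
  show ?thesis
    unfolding 1 2 using 3 by (simp only: mult.assoc)
qed

text \<open>
  Each power of \<open>z = q\<^sup>x \<alpha>\<close> times the weight is a sum of two Gaussians with the quadratic coefficient \<open>-2 log q\<close>.
\<close>
lemma monomial_integrand_eq:
  fixes q \<alpha> :: complex and x :: real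
  assumes q0: "q \<noteq> 0" and a0: "\<alpha> \<noteq> 0"
  shows "(1 + q powr (2 * of_real x) * \<alpha>\<^sup>2) * (q powr of_real x * \<alpha>) powi p
          * q powr (2 * (of_real x)\<^sup>2 - of_real x) * \<alpha> powr (4 * of_real x) =
         \<alpha> powi p * exp (((of_int p - 1) * Ln q + 4 * Ln \<alpha>) * of_real x - (- 2 * Ln q) * of_real (x\<^sup>2)) +
         \<alpha> powi (p + 2) * exp (((of_int p + 1) * Ln q + 4 * Ln \<alpha>) * of_real x - (- 2 * Ln q) * of_real (x\<^sup>2))"
proof -
  define A where "A = Ln \<alpha>"
  define Q where "Q = Ln q"
  have \<alpha>: "\<alpha> powr s = exp (s * A)" for s using a0 by (simp add: powr_def A_def)
  have q: "q powr s = exp (s * Q)" for s using q0 by (simp add: powr_def Q_def)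
  have \<alpha>p: "\<alpha> powi (p + 2) = \<alpha> powi p * \<alpha>\<^sup>2"
    using a0 by (simp add: power_int_add)
  have e1: "exp (of_int p * (of_real x * Q)) * exp ((2 * (of_real x)\<^sup>2 - of_real x) * Q) * exp (4 * of_real x * A) =
        exp (((of_int p - 1) * Q + 4 * A) * of_real x - (- 2 * Q) * of_real (x\<^sup>2))"
    unfolding mult_exp_exp by (rule arg_cong[of _ _ exp]) (simp add: algebra_simps)
  have e2: "exp (2 * of_real x * Q) * (exp (of_int p * (of_real x * Q)) * exp ((2 * (of_real x)\<^sup>2 - of_real x) * Q) * exp (4 * of_real x * A)) =
        exp (((of_int p + 1) * Q + 4 * A) * of_real x - (- 2 * Q) * of_real (x\<^sup>2))"
    unfolding mult_exp_exp by (rule arg_cong[of _ _ exp]) (simp add: algebra_simps)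
  show ?thesis
    unfolding A_def[symmetric] Q_def[symmetric] e1[symmetric] e2[symmetric] \<alpha>p q \<alpha> power_int_mult_distrib exp_power_int
    by (simp only: distrib_right distrib_left mult_1_left mult_1_right mult_ac)
qed

lemma Re_minus_two_Ln:
  assumes "0 < norm q" "norm q < 1"
  shows "Re (- 2 * Ln q) > 0"
  using assms by (auto simp: ln_less_zero)

lemma monomial_integrand_integrable:
  fixes q \<alpha> :: complex
  assumes q: "0 < norm q" "norm q < 1" and a0: "\<alpha> \<noteq> 0"
  shows "integrable lborel (\<lambda>x::real. (1 + q powr (2 * of_real x) * \<alpha>\<^sup>2) * (q powr of_real x * \<alpha>) powi p
          * q powr (2 * (of_real x)\<^sup>2 - of_real x) * \<alpha> powr (4 * of_real x))"
proof -
  have q0: "q \<noteq> 0" using q by auto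
  show ?thesis
    unfolding monomial_integrand_eq[OF q0 a0]
    by (intro Bochner_Integration.integrable_add integrable_mult_right complex_gaussian_integral(1)
          Re_minus_two_Ln[OF q])
qed

lemma Hermite_integrand_integrable:
  fixes q \<alpha> :: complex
  assumes q: "0 < norm q" "norm q < 1" and a0: "\<alpha> \<noteq> 0"
  shows "integrable lborel (\<lambda>x::real. (1 + q powr (2 * of_real x) * \<alpha>\<^sup>2)
          * qinv_Hermite n (q powr of_real x * \<alpha>) q * qinv_Hermite m (q powr of_real x * \<alpha>) q
          * q powr (2 * (of_real x)\<^sup>2 - of_real x) * \<alpha> powr (4 * of_real x))"
proof -
  have q0: "q \<noteq> 0" using q by auto
  have "(1 + q powr (2 * of_real x) * \<alpha>\<^sup>2)
          * qinv_Hermite n (q powr of_real x * \<alpha>) q * qinv_Hermite m (q powr of_real x * \<alpha>) q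
          * q powr (2 * (of_real x)\<^sup>2 - of_real x) * \<alpha> powr (4 * of_real x) =
        (\<Sum>l\<le>m. \<Sum>i\<le>n. (qinv_coeff q m l * qinv_coeff q n i) *
           ((1 + q powr (2 * of_real x) * \<alpha>\<^sup>2) * (q powr of_real x * \<alpha>) powi (int n - 2 * int i + (int m - 2 * int l))
          * q powr (2 * (of_real x)\<^sup>2 - of_real x) * \<alpha> powr (4 * of_real x)))" for x :: real
  proof -
    define z where "z = q powr of_real x * \<alpha>"
    have z: "z \<noteq> 0" using q0 a0 by (simp add: z_def)
    have "C * qinv_Hermite n z q * qinv_Hermite m z q * D * E = (qinv_Hermite m z q * qinv_Hermite n z q) * (C * D * E)"
      for C D E by (simp only: mult_ac)
    also have "(qinv_Hermite m z q * qinv_Hermite n z q) * (C * D * E) =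
        (\<Sum>l\<le>m. \<Sum>i\<le>n. (qinv_coeff q m l * qinv_coeff q n i) * (C * z powi (int n - 2 * int i + (int m - 2 * int l)) * D * E))"
      for C D E
      unfolding qinv_Hermite_Laurent[OF z] unfolding sum_product unfolding sum_distrib_right
        power_int_add[OF disjI1[OF z]] by (intro sum.cong refl) (simp only: mult_ac)
    finally show ?thesis unfolding z_def .
  qed
  thus ?thesis
    by (simp only:) (intro Bochner_Integration.integrable_sum integrable_mult_right
         monomial_integrand_integrable[OF q a0])
qed

text \<open>
  With \<open>L = - log q\<close> and \<open>a = log \<alpha>\<close>, both Gaussians have the same integral up to the factors \<open>exp (\<plusminus>a)\<close>, and the coefficients \<open>1\<close> and
  \<open>\<alpha>\<^sup>2\<close> turn these into equal contributions \<open>\<alpha>\<close>.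
\<close>
lemma weight_integral:
  fixes q \<alpha> :: complex
  assumes q: "0 < norm q" "norm q < 1" and a0: "\<alpha> \<noteq> 0"
  shows "(LINT x|lborel. (1 + q powr (2 * of_real x) * \<alpha>\<^sup>2)
            * q powr (2 * (of_real x)\<^sup>2 - of_real x) * \<alpha> powr (4 * of_real x)) =
         of_real (sqrt (2 * pi)) * \<alpha> * exp (2 * (Ln \<alpha>)\<^sup>2 / (- Ln q)) / (q powr (1 / 8) * csqrt (- Ln q))"
proof -
  have q0: "q \<noteq> 0" using q by auto
  define a where "a = Ln \<alpha>"
  define L where "L = - Ln q"
  have L: "Re (2 * L) > 0" using Re_minus_two_Ln[OF q] by (simp add: L_def)
  hence L0: "L \<noteq> 0" by auto
  have \<alpha>: "exp a = \<alpha>" using a0 by (simp add: a_def)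
  define C where "C = of_real (sqrt pi) * (2 * L) powr (- (1 / 2))"
  have "(LINT x|lborel. (1 + q powr (2 * of_real x) * \<alpha>\<^sup>2)
            * q powr (2 * (of_real x)\<^sup>2 - of_real x) * \<alpha> powr (4 * of_real x)) =
        (LINT x|lborel. exp ((L + 4 * a) * of_real x - 2 * L * of_real (x\<^sup>2)) +
           \<alpha>\<^sup>2 * exp ((- L + 4 * a) * of_real x - 2 * L * of_real (x\<^sup>2)))"
    using monomial_integrand_eq[OF q0 a0, where p = 0] by (simp add: L_def a_def)
  also have "\<dots> = C * exp ((L + 4 * a)\<^sup>2 / (4 * (2 * L))) + \<alpha>\<^sup>2 * (C * exp ((- L + 4 * a)\<^sup>2 / (4 * (2 * L))))"
    using complex_gaussian_integral[OF L, of "L + 4 * a"] complex_gaussian_integral[OF L, of "- L + 4 * a"]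
    by (subst Bochner_Integration.integral_add) (simp_all add: C_def)
  also have "(L + 4 * a)\<^sup>2 / (4 * (2 * L)) = L / 8 + a + 2 * a\<^sup>2 / L"
    using L0 by (simp add: power2_eq_square field_simps)
  also have "(- L + 4 * a)\<^sup>2 / (4 * (2 * L)) = L / 8 - a + 2 * a\<^sup>2 / L"
    using L0 by (simp add: power2_eq_square field_simps)
  also have "C * exp (L / 8 + a + 2 * a\<^sup>2 / L) + \<alpha>\<^sup>2 * (C * exp (L / 8 - a + 2 * a\<^sup>2 / L)) =
             (2 * C) * \<alpha> * exp (2 * a\<^sup>2 / L) * exp (L / 8)"
  proof -
    define X where "X = 2 * a\<^sup>2 / L"
    have "exp (L / 8 + a + X) = exp (L / 8) * \<alpha> * exp X"
      "exp (L / 8 - a + X) = exp (L / 8) / \<alpha> * exp X"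
      by (simp_all only: exp_add exp_diff \<alpha>)
    moreover have "C * (E * \<alpha> * F) + \<alpha>\<^sup>2 * (C * (E / \<alpha> * F)) = (2 * C) * \<alpha> * F * E" for E F
      using a0 by (simp add: power2_eq_square)
    ultimately show ?thesis
      unfolding X_def[symmetric] by (simp only:)
  qed
  also have "2 * C = of_real (sqrt (2 * pi)) / csqrt L"
  proof -
    have "(2 * L) powr (- (1 / 2)) = (of_real 2) powr (- (1 / 2)) * L powr (- (1 / 2))"
      using powr_times_real_left[of "of_real 2" L "- (1 / 2)"] by simp
    also have "(of_real 2 :: complex) powr (- (1 / 2)) = of_real (2 powr (- (1 / 2)))"
      using powr_of_real[of 2 "- (1 / 2)"] by simp
    also have "2 powr (- (1 / 2)) = 1 / sqrt 2"
      by (simp only: powr_minus powr_half_sqrt zero_le_numeral inverse_eq_divide)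
    also have "L powr (- (1 / 2)) = 1 / csqrt L"
      by (simp only: powr_minus csqrt_conv_powr inverse_eq_divide)
    finally have "2 * C = of_real (2 * sqrt pi / sqrt 2) / csqrt L"
      by (simp add: C_def)
    also have "2 * sqrt pi / sqrt 2 = sqrt (2 * pi)"
    proof -
      have "2 * sqrt pi / sqrt 2 = (2 / sqrt 2) * sqrt pi" by simp
      also have "2 / sqrt 2 = sqrt (2::real)" by (rule real_div_sqrt) simp
      finally show ?thesis by (simp only: real_sqrt_mult)
    qed
    finally show ?thesis .
  qed
  also have "exp (L / 8) = 1 / q powr (1 / 8)"
    using q0 by (simp add: powr_def L_def exp_minus inverse_eq_divide)
  finally show ?thesis
    by (simp add: L_def a_def)
qed

section \<open>The orthogonality relations\<close>

theorem theorem4p1: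
  fixes m n :: nat and q \<alpha> :: complex
  assumes "0 < norm q" and "norm q < 1" and "\<alpha> \<noteq> 0"
  shows
   "(\<forall>\<beta>. \<beta> \<noteq> 0 \<longrightarrow>
       (\<lambda>k::int. (1 + q powi (2 * k) * \<beta>\<^sup>2)
          * qinv_Hermite n (q powi k * \<beta>) q * qinv_Hermite m (q powi k * \<beta>) q
          * q powi (2 * k\<^sup>2 - k) * \<beta> powi (4 * k)) summable_on UNIV)
    \<and> Psi m n \<alpha> q =
        qpoch_inf_list [q, - (\<alpha>\<^sup>2), - (q / \<alpha>\<^sup>2)] q
        * (q powi (- int (n choose 2)) * qpoch q q n / q ^ n) * (if m = n then 1 else 0)
    \<and> integrable lborel (\<lambda>x::real. (1 + q powr (2 * of_real x) * \<alpha>\<^sup>2)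
          * qinv_Hermite n (q powr of_real x * \<alpha>) q * qinv_Hermite m (q powr of_real x * \<alpha>) q
          * q powr (2 * (of_real x)\<^sup>2 - of_real x) * \<alpha> powr (4 * of_real x))
    \<and> set_integrable lborel {0..1} (\<lambda>x::real. Psi m n (q powr of_real x * \<alpha>) q
          * q powr (2 * (of_real x)\<^sup>2 - of_real x) * \<alpha> powr (4 * of_real x))
    \<and> (LINT x|lborel. (1 + q powr (2 * of_real x) * \<alpha>\<^sup>2)
          * qinv_Hermite n (q powr of_real x * \<alpha>) q * qinv_Hermite m (q powr of_real x * \<alpha>) q
          * q powr (2 * (of_real x)\<^sup>2 - of_real x) * \<alpha> powr (4 * of_real x))
      = (LINT x:{0..1}|lborel. Psi m n (q powr of_real x * \<alpha>) q
          * q powr (2 * (of_real x)\<^sup>2 - of_real x) * \<alpha> powr (4 * of_real x))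
    \<and> (LINT x:{0..1}|lborel. Psi m n (q powr of_real x * \<alpha>) q
          * q powr (2 * (of_real x)\<^sup>2 - of_real x) * \<alpha> powr (4 * of_real x))
      = qpoch_inf q q
        * (q powi (- int (n choose 2)) * qpoch q q n * (if m = n then 1 else 0) / q ^ n)
        * J_integral \<alpha> q
    \<and> set_integrable lborel {0..1} (\<lambda>x::real.
          qpoch_inf_list [- (q powr (2 * of_real x)) * \<alpha>\<^sup>2, - (q powr (1 - 2 * of_real x)) / \<alpha>\<^sup>2] q
          * q powr (2 * (of_real x)\<^sup>2 - of_real x) * \<alpha> powr (4 * of_real x))
    \<and> integrable lborel (\<lambda>x::real. (1 + q powr (2 * of_real x) * \<alpha>\<^sup>2)
          * q powr (2 * (of_real x)\<^sup>2 - of_real x) * \<alpha> powr (4 * of_real x))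
    \<and> J_integral \<alpha> q
      = 1 / qpoch_inf q q
        * (LINT x|lborel. (1 + q powr (2 * of_real x) * \<alpha>\<^sup>2)
            * q powr (2 * (of_real x)\<^sup>2 - of_real x) * \<alpha> powr (4 * of_real x))
    \<and> 1 / qpoch_inf q q
        * (LINT x|lborel. (1 + q powr (2 * of_real x) * \<alpha>\<^sup>2)
            * q powr (2 * (of_real x)\<^sup>2 - of_real x) * \<alpha> powr (4 * of_real x))
      = of_real (sqrt (2 * pi)) * \<alpha> * exp (2 * (Ln \<alpha>)\<^sup>2 / (- Ln q))
        / (q powr (1 / 8) * csqrt (- Ln q) * qpoch_inf q q)"
proof -
  note q = assms(1,2) and a0 = assms(3)
  have q0: "q \<noteq> 0" using q by auto
  define W where "W x = q powr (2 * (of_real x)\<^sup>2 - of_real x) * \<alpha> powr (4 * of_real x)" for x :: real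
  define b where "b x = q powr of_real x * \<alpha>" for x :: real
  define \<Theta> where "\<Theta> z = infsum (theta_term q (z\<^sup>2)) UNIV" for z
  define N where "N = q powi (- int (n choose 2)) * qpoch q q n / q ^ n * (if m = n then 1 else 0)"
  define h where "h m n x = (1 + q powr (2 * of_real x) * \<alpha>\<^sup>2)
          * qinv_Hermite n (q powr of_real x * \<alpha>) q * qinv_Hermite m (q powr of_real x * \<alpha>) q
          * q powr (2 * (of_real x)\<^sup>2 - of_real x) * \<alpha> powr (4 * of_real x)" for m n and x :: real
  define j where "j x = qpoch_inf_list [- (q powr (2 * of_real x)) * \<alpha>\<^sup>2, - (q powr (1 - 2 * of_real x)) / \<alpha>\<^sup>2] q
          * q powr (2 * (of_real x)\<^sup>2 - of_real x) * \<alpha> powr (4 * of_real x)" for x :: real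
  have b: "b x \<noteq> 0" for x using q0 a0 by (simp add: b_def)
  have nz: "qpoch_inf q q \<noteq> 0" by (rule qpoch_inf_self_nonzero[OF q(2)])
  have \<Theta>: "\<Theta> z = qpoch_inf_list [q, - (z\<^sup>2), - (q / z\<^sup>2)] q" if "z \<noteq> 0" for z
    using jacobi_triple_product[OF q, of "z\<^sup>2"] that by (simp add: \<Theta>_def qpoch_inf_list_def)
  have Psi: "Psi m n z q = N * \<Theta> z" if "z \<noteq> 0" for z
    using Psi_eq_theta[OF q that] by (simp add: N_def \<Theta>_def)
  \<comment> \<open>The case \<open>m = n = 0\<close> represents the theta function itself, so the statements about \<open>J\<close> are unfoldings as well.\<close>
  have Psi00: "Psi 0 0 z q = \<Theta> z" if "z \<noteq> 0" for z
    using Psi_eq_theta[OF q that, of 0 0] by (simp add: \<Theta>_def qpoch_def numeral_2_eq_2)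
  have h_int: "integrable lborel (h m n)" for m n
    unfolding h_def[abs_def] by (rule Hermite_integrand_integrable[OF q a0])
  have h_sum: "((\<lambda>k::int. h m n (x + of_int k)) has_sum Psi m n (b x) q * W x) UNIV" for m n x
    unfolding h_def Psi_term_shift[OF q0 a0] W_def Psi_def b_def
    by (fold b_def, intro has_sum_cmult_left has_sum_infsum has_sum_imp_summable[OF Psi_has_sum_moments[OF q b]])
  have unfold_h: "set_integrable lborel {0..1} (\<lambda>x. Psi m n (b x) q * W x)"
       "(LINT x:{0..1}|lborel. Psi m n (b x) q * W x) = (LINT x|lborel. h m n x)" for m n
    using integral_periodization[OF h_int has_sum_imp_summable[OF h_sum], of m n]
    by (simp_all only: infsumI[OF h_sum])
  have h00: "h 0 0 x = (1 + q powr (2 * of_real x) * \<alpha>\<^sup>2)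
            * q powr (2 * (of_real x)\<^sup>2 - of_real x) * \<alpha> powr (4 * of_real x)" for x
    by (simp add: h_def qinv_Hermite_def cont_q_Hermite_def qpoch_def)
  have \<Theta>W: "\<Theta> (b x) * W x = qpoch_inf q q * j x" for x
  proof -
    have "(b x)\<^sup>2 = q powr (2 * of_real x) * \<alpha>\<^sup>2"
      using q0 by (simp add: b_def power_mult_distrib powr_def exp_double mult.assoc)
    moreover have "q / (q powr (2 * of_real x) * \<alpha>\<^sup>2) = q powr (1 - 2 * of_real x) / \<alpha>\<^sup>2"
      using q0 by (simp add: powr_diff)
    ultimately show ?thesis
      unfolding \<Theta>[OF b] j_def W_def by (simp add: qpoch_inf_list_def mult_ac)
  qed
  have \<Theta>_int: "set_integrable lborel {0..1} (\<lambda>x. \<Theta> (b x) * W x)"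
      "(LINT x:{0..1}|lborel. \<Theta> (b x) * W x) = (LINT x|lborel. h 0 0 x)"
    using unfold_h[of 0 0] by (simp_all only: Psi00[OF b])
  have j_int: "set_integrable lborel {0..1} j"
  proof -
    have "set_integrable lborel {0..1} (\<lambda>x. 1 / qpoch_inf q q * (\<Theta> (b x) * W x))"
      by (intro set_integrable_mult_right \<Theta>_int)
    thus ?thesis
      unfolding \<Theta>W using nz by simp
  qed
  have J: "qpoch_inf q q * J_integral \<alpha> q = (LINT x:{0..1}|lborel. \<Theta> (b x) * W x)"
    unfolding \<Theta>W J_integral_def j_def[symmetric] by simp
  have 1: "\<forall>\<beta>. \<beta> \<noteq> 0 \<longrightarrow>
       (\<lambda>k::int. (1 + q powi (2 * k) * \<beta>\<^sup>2)
          * qinv_Hermite n (q powi k * \<beta>) q * qinv_Hermite m (q powi k * \<beta>) q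
          * q powi (2 * k\<^sup>2 - k) * \<beta> powi (4 * k)) summable_on UNIV"
    using has_sum_imp_summable[OF Psi_has_sum_moments[OF q]] by blast
  have 2: "Psi m n \<alpha> q = qpoch_inf_list [q, - (\<alpha>\<^sup>2), - (q / \<alpha>\<^sup>2)] q
        * (q powi (- int (n choose 2)) * qpoch q q n / q ^ n) * (if m = n then 1 else 0)"
    unfolding Psi[OF a0] \<Theta>[OF a0] N_def by (simp only: mult_ac)
  have 3: "(LINT x:{0..1}|lborel. Psi m n (b x) q * W x) = qpoch_inf q q
        * (q powi (- int (n choose 2)) * qpoch q q n * (if m = n then 1 else 0) / q ^ n) * J_integral \<alpha> q"
  proof -
    have "(LINT x:{0..1}|lborel. Psi m n (b x) q * W x) = N * (LINT x:{0..1}|lborel. \<Theta> (b x) * W x)"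
      unfolding Psi[OF b] mult.assoc by simp
    thus ?thesis by (simp add: J[symmetric] N_def)
  qed
  have 4: "J_integral \<alpha> q = 1 / qpoch_inf q q * (LINT x|lborel. h 0 0 x)"
    using nz J \<Theta>_int(2) by (simp add: field_simps)
  have 5: "1 / qpoch_inf q q * (LINT x|lborel. h 0 0 x) =
      of_real (sqrt (2 * pi)) * \<alpha> * exp (2 * (Ln \<alpha>)\<^sup>2 / (- Ln q)) / (q powr (1 / 8) * csqrt (- Ln q) * qpoch_inf q q)"
    unfolding h00 weight_integral[OF q a0] by simp
  show ?thesis
    using 1 2 h_int[of m n] unfold_h(1)[of m n] unfold_h(2)[of m n, symmetric] 3 j_int h_int[of 0 0] 4 5
    unfolding h00[abs_def] unfolding h_def[abs_def] j_def[abs_def] W_def b_def mult.assoc[symmetric]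
    by - (intro conjI; assumption)
qed

end
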